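(* Let $\mathcal{S}$ be the class of graphs $G$ with $\sigma(G)>(|G|+3)/2$; let $\mathcal{S}_1$ be the class of graphs $G$ with $\sigma(G)>(|G|+3)/2$ whose largest similarity class is an inclusion-maximal homogeneous set; let $\mathcal{S}_2$ be the class of graphs $G$ with $\sigma(G)>(|G|+1)/2$ whose largest similarity class is not an inclusion-maximal homogeneous set. (a) $\mathrm{L}(G)\le(|G|+5)/2$ with the exception of all graphs in $\mathcal{S}$. If $G\in\mathcal{S}$, then $\mathrm{L}(G)=\sigma(G)+1$. (b) $\mathrm{D}_1(G)\le(|G|+5)/2$ with the exception of all graphs in $\mathcal{S}_1\cup\mathcal{S}_2$. If $G\in\mathcal{S}_1$, then $\mathrm{D}(G)=\sigma(G)+1$; if $G\in\mathcal{S}_2$, then $\mathrm{D}(G)=\sigma(G)+2$.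
   Context: Graphs are finite, undirected and loopless; $|G|$ is the number of vertices of $G$. A graph is regarded as a structure with a single irreflexive symmetric binary predicate $E$ (adjacency). First order formulas use $E$, $=$ and the connectives $\neg,\wedge,\vee$. A closed formula $\Phi$ distinguishes $G$ from $G'$ if it is true on $G$ and false on $G'$. It defines $G$ if it distinguishes $G$ from every (finite) structure with a single binary relation not isomorphic to $G$, of any order (equivalently for the parameters below, from every graph not isomorphic to $G$). Two vertices $u,v$ of $G$ are similar, $u\sim v$, if the transposition $(uv)$ is an automorphism of $G$; $\sim$ is an equivalence relation, its classes are called similarity classes, $[u]_G$ denotes the class of $u$, $\sigma_G(u)=|[u]_G|$ and $\sigma(G)=\max_{u}\sigma_G(u)$. A set of vertices is homogeneous if it is a clique or an independent set. The set $\mathrm{Nest}(\Phi)$ of sequences of nested quantifiers is defined inductively: $\mathrm{Nest}(\Phi)=\{\epsilon\}$ (the empty word) for atomic $\Phi$; $\mathrm{Nest}(\neg\Phi)$ is obtained from $\mathrm{Nest}(\Phi)$ by exchanging $\exists$ and $\forall$ in all words; $\mathrm{Nest}(\Phi\wedge\Psi)=\mathrm{Nest}(\Phi\vee\Psi)=\mathrm{Nest}(\Phi)\cup\mathrm{Nest}(\Psi)$; $\mathrm{Nest}(\exists x\Phi)$ and $\mathrm{Nest}(\forall x\Phi)$ are obtained by prepending $\exists$, respectively $\forall$, to every word of $\mathrm{Nest}(\Phi)$. The quantifier rank of $\Phi$ is the maximum length of a word in $\mathrm{Nest}(\Phi)$; the alternation number of $\Phi$ is the maximum, over words in $\mathrm{Nest}(\Phi)$,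 of the number of occurrences of $\exists\forall$ and $\forall\exists$ as consecutive letters. $\mathrm{D}(G)$ (respectively $\mathrm{D}_k(G)$) is the minimum quantifier rank of a formula (respectively of a formula with alternation number at most $k$) defining $G$. $\mathrm{L}(G,G')$ is the minimum $l$ such that some formula over the variable set $\{x_1,\ldots,x_l\}$ (variables may be requantified) distinguishes $G$ from $G'$, and $\mathrm{L}(G)=\max\{\mathrm{L}(G,G'): G'\not\cong G\}$. *)

theory Defs
  imports "Graph_Theory.Pair_Digraph" "Graph_Theory.Digraph_Isomorphism"
    "HOL-Combinatorics.Transposition" "HOL-Library.Extended_Real"
begin

section \<open>Graphs and binary structures\<close>

text \<open>A structure with a single binary relation is a vertex set \<open>pverts\<close> together with a
  relation \<open>parcs\<close> on it.  The library's \<open>pair_graph\<close> says that it is finite, loopless and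
  symmetric.  As usual in model theory, universes are nonempty.\<close>

definition finite_structure :: "'a pair_pre_digraph \<Rightarrow> bool" where
  "finite_structure G \<longleftrightarrow> pair_fin_digraph G \<and> pverts G \<noteq> {}"

definition finite_graph :: "'a pair_pre_digraph \<Rightarrow> bool" where
  "finite_graph G \<longleftrightarrow> pair_graph G \<and> pverts G \<noteq> {}"

definition order :: "'a pair_pre_digraph \<Rightarrow> nat" where
  "order G = card (pverts G)"

definition isomorphism :: "('a \<Rightarrow> 'b) \<Rightarrow> 'a pair_pre_digraph \<Rightarrow> 'b pair_pre_digraph \<Rightarrow> bool" where
  "isomorphism f G H \<longleftrightarrow> bij_betw f (pverts G) (pverts H) \<and>
     (\<forall>u\<in>pverts G. \<forall>v\<in>pverts G. (u, v) \<in> parcs G \<longleftrightarrow> (f u, f v) \<in> parcs H)"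

definition isomorphic :: "'a pair_pre_digraph \<Rightarrow> 'b pair_pre_digraph \<Rightarrow> bool" where
  "isomorphic G H \<longleftrightarrow> (\<exists>f. isomorphism f G H)"

section \<open>Similarity classes\<close>

definition similarity :: "'a pair_pre_digraph \<Rightarrow> 'a rel" where
  "similarity G = {(u, v). u \<in> pverts G \<and> v \<in> pverts G \<and> isomorphism (transpose u v) G G}"

definition sim_class :: "'a pair_pre_digraph \<Rightarrow> 'a \<Rightarrow> 'a set" where
  "sim_class G u = similarity G `` {u}"

definition sigma :: "'a pair_pre_digraph \<Rightarrow> nat" where
  "sigma G = Max ((\<lambda>u. card (sim_class G u)) ` pverts G)"

definition homogeneous :: "'a pair_pre_digraph \<Rightarrow> 'a set \<Rightarrow> bool" where
  "homogeneous G X \<longleftrightarrow> X \<subseteq> pverts G \<and>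
     ((\<forall>u\<in>X. \<forall>v\<in>X. u \<noteq> v \<longrightarrow> (u, v) \<in> parcs G) \<or>
      (\<forall>u\<in>X. \<forall>v\<in>X. u \<noteq> v \<longrightarrow> (u, v) \<notin> parcs G))"

definition maximal_homogeneous :: "'a pair_pre_digraph \<Rightarrow> 'a set \<Rightarrow> bool" where
  "maximal_homogeneous G X \<longleftrightarrow> homogeneous G X \<and> (\<forall>Y. homogeneous G Y \<and> X \<subseteq> Y \<longrightarrow> Y = X)"

definition largest_class :: "'a pair_pre_digraph \<Rightarrow> 'a set \<Rightarrow> bool" where
  "largest_class G C \<longleftrightarrow> C \<in> sim_class G ` pverts G \<and> card C = sigma G"

definition class_S :: "'a pair_pre_digraph set" where
  "class_S = {G. finite_graph G \<and> real (sigma G) > (real (order G) + 3) / 2}"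

text \<open>A similarity class with more than half of the vertices is the only largest one, so the
  existential quantifiers below merely name it.\<close>

definition class_S1 :: "'a pair_pre_digraph set" where
  "class_S1 = {G. finite_graph G \<and> real (sigma G) > (real (order G) + 3) / 2 \<and>
     (\<exists>C. largest_class G C \<and> maximal_homogeneous G C)}"

definition class_S2 :: "'a pair_pre_digraph set" where
  "class_S2 = {G. finite_graph G \<and> real (sigma G) > (real (order G) + 1) / 2 \<and>
     (\<exists>C. largest_class G C \<and> \<not> maximal_homogeneous G C)}"

section \<open>First order formulas\<close>

datatype fm =
    Adj nat nat
  | Eq nat nat
  | Neg fm
  | Conj fm fm
  | Disj fm fm
  | Exi nat fm
  | All nat fm

primrec free_vars :: "fm \<Rightarrow> nat set" where
  "free_vars (Adj x y) = {x, y}"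
| "free_vars (Eq x y) = {x, y}"
| "free_vars (Neg \<phi>) = free_vars \<phi>"
| "free_vars (Conj \<phi> \<psi>) = free_vars \<phi> \<union> free_vars \<psi>"
| "free_vars (Disj \<phi> \<psi>) = free_vars \<phi> \<union> free_vars \<psi>"
| "free_vars (Exi x \<phi>) = free_vars \<phi> - {x}"
| "free_vars (All x \<phi>) = free_vars \<phi> - {x}"

primrec vars :: "fm \<Rightarrow> nat set" where
  "vars (Adj x y) = {x, y}"
| "vars (Eq x y) = {x, y}"
| "vars (Neg \<phi>) = vars \<phi>"
| "vars (Conj \<phi> \<psi>) = vars \<phi> \<union> vars \<psi>"
| "vars (Disj \<phi> \<psi>) = vars \<phi> \<union> vars \<psi>"
| "vars (Exi x \<phi>) = insert x (vars \<phi>)"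
| "vars (All x \<phi>) = insert x (vars \<phi>)"

primrec sat :: "'a pair_pre_digraph \<Rightarrow> (nat \<Rightarrow> 'a) \<Rightarrow> fm \<Rightarrow> bool" where
  "sat G e (Adj x y) \<longleftrightarrow> (e x, e y) \<in> parcs G"
| "sat G e (Eq x y) \<longleftrightarrow> e x = e y"
| "sat G e (Neg \<phi>) \<longleftrightarrow> \<not> sat G e \<phi>"
| "sat G e (Conj \<phi> \<psi>) \<longleftrightarrow> sat G e \<phi> \<and> sat G e \<psi>"
| "sat G e (Disj \<phi> \<psi>) \<longleftrightarrow> sat G e \<phi> \<or> sat G e \<psi>"
| "sat G e (Exi x \<phi>) \<longleftrightarrow> (\<exists>a\<in>pverts G. sat G (e(x := a)) \<phi>)"
| "sat G e (All x \<phi>) \<longleftrightarrow> (\<forall>a\<in>pverts G. sat G (e(x := a)) \<phi>)"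

text \<open>Used for closed formulas only, whose truth value does not depend on the assignment.\<close>

definition models :: "'a pair_pre_digraph \<Rightarrow> fm \<Rightarrow> bool" where
  "models G \<phi> \<longleftrightarrow> (\<forall>e. sat G e \<phi>)"

datatype quantifier = QEx | QAll

primrec dual :: "quantifier \<Rightarrow> quantifier" where
  "dual QEx = QAll"
| "dual QAll = QEx"

primrec Nest :: "fm \<Rightarrow> quantifier list set" where
  "Nest (Adj x y) = {[]}"
| "Nest (Eq x y) = {[]}"
| "Nest (Neg \<phi>) = map dual ` Nest \<phi>"
| "Nest (Conj \<phi> \<psi>) = Nest \<phi> \<union> Nest \<psi>"
| "Nest (Disj \<phi> \<psi>) = Nest \<phi> \<union> Nest \<psi>"
| "Nest (Exi x \<phi>) = (#) QEx ` Nest \<phi>"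
| "Nest (All x \<phi>) = (#) QAll ` Nest \<phi>"

definition alternations :: "quantifier list \<Rightarrow> nat" where
  "alternations w = card {i. Suc i < length w \<and> w ! i \<noteq> w ! Suc i}"

definition quantifier_rank :: "fm \<Rightarrow> nat" where
  "quantifier_rank \<phi> = Max (length ` Nest \<phi>)"

definition alternation_number :: "fm \<Rightarrow> nat" where
  "alternation_number \<phi> = Max (alternations ` Nest \<phi>)"

section \<open>Definability\<close>

definition distinguishes :: "fm \<Rightarrow> 'a pair_pre_digraph \<Rightarrow> 'b pair_pre_digraph \<Rightarrow> bool" where
  "distinguishes \<phi> G H \<longleftrightarrow> free_vars \<phi> = {} \<and> models G \<phi> \<and> \<not> models H \<phi>"

text \<open>Every finite structure is isomorphic to one whose vertices are natural numbers; letting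
  \<open>H\<close> range over the latter therefore covers all finite structures
  (see \<open>fo_defines_any_type\<close> below).\<close>

definition fo_defines :: "fm \<Rightarrow> 'a pair_pre_digraph \<Rightarrow> bool" where
  "fo_defines \<phi> G \<longleftrightarrow>
     (\<forall>H :: nat pair_pre_digraph. finite_structure H \<and> \<not> isomorphic G H \<longrightarrow> distinguishes \<phi> G H)"

text \<open>The parameters take values in \<open>enat\<close>: a minimum over the empty set is \<open>\<infinity>\<close>, not
  an arbitrary number, and so is a supremum of an unbounded set of numbers.  A nonempty set of
  extended naturals contains its infimum, and its supremum when that is finite, so that these
  are the minima and maxima of the usual definitions.\<close>

definition depth :: "'a pair_pre_digraph \<Rightarrow> enat" where
  "depth G = (INF \<phi>\<in>{\<phi>. fo_defines \<phi> G}. enat (quantifier_rank \<phi>))"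

definition depth_alt :: "nat \<Rightarrow> 'a pair_pre_digraph \<Rightarrow> enat" where
  "depth_alt k G =
     (INF \<phi>\<in>{\<phi>. fo_defines \<phi> G \<and> alternation_number \<phi> \<le> k}. enat (quantifier_rank \<phi>))"

definition width_dist :: "'a pair_pre_digraph \<Rightarrow> 'b pair_pre_digraph \<Rightarrow> enat" where
  "width_dist G H = (INF l\<in>{l. \<exists>\<phi>. vars \<phi> \<subseteq> {1..l} \<and> distinguishes \<phi> G H}. enat l)"

definition width :: "'a pair_pre_digraph \<Rightarrow> enat" where
  "width G = (SUP H\<in>{H :: nat pair_pre_digraph. finite_graph H \<and> \<not> isomorphic G H}. width_dist G H)"

section \<open>Checks of the encoding\<close>

lemma isomorphic_iff_digraph_iso:
  assumes "pair_wf_digraph G" "pair_wf_digraph H"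
  shows "isomorphic G H \<longleftrightarrow> digraph_iso (with_proj G) (with_proj H)"
proof
  interpret G: pair_wf_digraph G by fact
  interpret H: pair_wf_digraph H by fact
  assume "isomorphic G H"
  then obtain f where f: "isomorphism f G H" by (auto simp: isomorphic_def)
  let ?h = "\<lparr>iso_verts = f, iso_arcs = map_prod f f, iso_head = snd, iso_tail = fst\<rparr>"
  have inj: "inj_on f (pverts G)" and im: "f ` pverts G = pverts H"
    using f by (auto simp: isomorphism_def bij_betw_def)
  have "inj_on (map_prod f f) (pverts G \<times> pverts G)" using inj by (simp add: map_prod_inj_on)
  moreover have sub: "parcs G \<subseteq> pverts G \<times> pverts G" by (auto simp: G.in_arcsD1 G.in_arcsD2)
  ultimately have "inj_on (map_prod f f) (parcs G)" by (rule inj_on_subset)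
  then have "pre_digraph.digraph_isomorphism (with_proj G) ?h"
    using inj G.wf_digraph_axioms by (auto simp: pre_digraph.digraph_isomorphism_def)
  moreover have "map_prod f f ` parcs G = parcs H"
  proof
    show "map_prod f f ` parcs G \<subseteq> parcs H"
      using f sub by (auto simp: isomorphism_def)
    show "parcs H \<subseteq> map_prod f f ` parcs G"
    proof
      fix e assume e: "e \<in> parcs H"
      then have "fst e \<in> f ` pverts G" "snd e \<in> f ` pverts G"
        using im H.arc_fst_in_verts H.arc_snd_in_verts by auto
      then obtain u v where uv: "u \<in> pverts G" "v \<in> pverts G" "e = (f u, f v)"
        by (metis imageE prod.collapse)
      then have "(u, v) \<in> parcs G" using f e by (simp add: isomorphism_def)
      then show "e \<in> map_prod f f ` parcs G" using uv(3) by force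
    qed
  qed
  then have "with_proj H = app_iso ?h (with_proj G)"
    using im by (simp add: app_iso_def with_proj_def)
  ultimately show "digraph_iso (with_proj G) (with_proj H)" by (auto simp: digraph_iso_def)
next
  interpret G: pair_wf_digraph G by fact
  assume "digraph_iso (with_proj G) (with_proj H)"
  then obtain h where h: "pre_digraph.digraph_isomorphism (with_proj G) h"
    and eq: "with_proj H = app_iso h (with_proj G)" by (auto simp: digraph_iso_def)
  let ?f = "iso_verts h"
  have V: "pverts H = ?f ` pverts G" and A: "parcs H = iso_arcs h ` parcs G"
    and "iso_tail h = fst" "iso_head h = snd"
    using eq by (auto simp: app_iso_def with_proj_def)
  then have arc: "iso_arcs h a = (?f (fst a), ?f (snd a))" if "a \<in> parcs G" for a
    using h that by (simp add: pre_digraph.digraph_isomorphism_def prod_eq_iff)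
  have inj: "inj_on ?f (pverts G)" using h by (simp add: pre_digraph.digraph_isomorphism_def)
  have "(u, v) \<in> parcs G \<longleftrightarrow> (?f u, ?f v) \<in> parcs H" if uv: "u \<in> pverts G" "v \<in> pverts G" for u v
  proof
    assume "(u, v) \<in> parcs G"
    then show "(?f u, ?f v) \<in> parcs H" using A arc[of "(u, v)"] by (metis fst_conv image_eqI snd_conv)
  next
    assume "(?f u, ?f v) \<in> parcs H"
    then obtain x y where xy: "(x, y) \<in> parcs G" "?f u = ?f x" "?f v = ?f y"
      using A arc by auto
    then have "u = x" "v = y"
      using inj_onD[OF inj] uv G.in_arcsD1[OF xy(1)] G.in_arcsD2[OF xy(1)] by auto
    then show "(u, v) \<in> parcs G" using xy by simp
  qed
  then have "isomorphism ?f G H" using inj V by (simp add: isomorphism_def bij_betw_def)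
  then show "isomorphic G H" by (auto simp: isomorphic_def)
qed

lemma isomorphism_sym:
  assumes f: "isomorphism f G H"
  shows "isomorphism (inv_into (pverts G) f) H G"
proof -
  let ?g = "inv_into (pverts G) f"
  have bij: "bij_betw f (pverts G) (pverts H)" using f by (simp add: isomorphism_def)
  have g: "?g x \<in> pverts G \<and> f (?g x) = x" if "x \<in> pverts H" for x
    using that bij by (simp add: bij_betw_def inv_into_into f_inv_into_f)
  have "(x, y) \<in> parcs H \<longleftrightarrow> (?g x, ?g y) \<in> parcs G" if "x \<in> pverts H" "y \<in> pverts H" for x y
    using f g[OF that(1)] g[OF that(2)] unfolding isomorphism_def by metis
  then show ?thesis using bij_betw_inv_into[OF bij] by (simp add: isomorphism_def)
qed

lemma isomorphic_sym: "isomorphic G H \<Longrightarrow> isomorphic H G"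
  unfolding isomorphic_def using isomorphism_sym by blast

lemma isomorphic_trans:
  assumes "isomorphic G H" "isomorphic H K"
  shows "isomorphic G K"
proof -
  obtain f g where f: "isomorphism f G H" and g: "isomorphism g H K"
    using assms by (auto simp: isomorphic_def)
  have "f u \<in> pverts H" if "u \<in> pverts G" for u
    using that f by (auto simp: isomorphism_def bij_betw_def)
  moreover have "bij_betw (g \<circ> f) (pverts G) (pverts K)"
    by (rule bij_betw_trans[of f _ "pverts H"]) (use f g in \<open>simp_all add: isomorphism_def\<close>)
  ultimately have "isomorphism (g \<circ> f) G K"
    using f g by (simp add: isomorphism_def)
  then show ?thesis by (auto simp: isomorphic_def)
qed

lemma sat_cong: "(\<And>x. x \<in> free_vars \<phi> \<Longrightarrow> e x = e' x) \<Longrightarrow> sat G e \<phi> \<longleftrightarrow> sat G e' \<phi>"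
proof (induction \<phi> arbitrary: e e')
  case (Neg \<phi>)
  have "sat G e \<phi> \<longleftrightarrow> sat G e' \<phi>" by (rule Neg.IH) (use Neg.prems in auto)
  then show ?case by simp
next
  case (Conj \<phi> \<psi>)
  have "sat G e \<phi> \<longleftrightarrow> sat G e' \<phi>" by (rule Conj.IH(1)) (use Conj.prems in auto)
  moreover have "sat G e \<psi> \<longleftrightarrow> sat G e' \<psi>" by (rule Conj.IH(2)) (use Conj.prems in auto)
  ultimately show ?case by simp
next
  case (Disj \<phi> \<psi>)
  have "sat G e \<phi> \<longleftrightarrow> sat G e' \<phi>" by (rule Disj.IH(1)) (use Disj.prems in auto)
  moreover have "sat G e \<psi> \<longleftrightarrow> sat G e' \<psi>" by (rule Disj.IH(2)) (use Disj.prems in auto)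
  ultimately show ?case by simp
next
  case (Exi x \<phi>)
  have "sat G (e(x := a)) \<phi> \<longleftrightarrow> sat G (e'(x := a)) \<phi>" for a
    by (rule Exi.IH) (use Exi.prems in auto)
  then show ?case by simp
next
  case (All x \<phi>)
  have "sat G (e(x := a)) \<phi> \<longleftrightarrow> sat G (e'(x := a)) \<phi>" for a
    by (rule All.IH) (use All.prems in auto)
  then show ?case by simp
qed auto

lemma models_closed: "free_vars \<phi> = {} \<Longrightarrow> models G \<phi> \<longleftrightarrow> sat G e \<phi>"
  unfolding models_def using sat_cong[of \<phi> _ e] by blast

lemma sat_isomorphism:
  assumes f: "isomorphism f G H"
  shows "range e \<subseteq> pverts G \<Longrightarrow> sat G e \<phi> \<longleftrightarrow> sat H (f \<circ> e) \<phi>"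
proof (induction \<phi> arbitrary: e)
  case (Adj x y)
  then have "e x \<in> pverts G" "e y \<in> pverts G" by auto
  then show ?case using f by (simp add: isomorphism_def)
next
  case (Eq x y)
  then have "e x \<in> pverts G" "e y \<in> pverts G" by auto
  then show ?case using f by (auto simp: isomorphism_def bij_betw_def dest: inj_onD)
next
  case (Exi x \<phi>)
  have "sat G (e(x := a)) \<phi> \<longleftrightarrow> sat H ((f \<circ> e)(x := f a)) \<phi>" if "a \<in> pverts G" for a
  proof -
    have "range (e(x := a)) \<subseteq> pverts G" using Exi.prems that by auto
    moreover have "f \<circ> e(x := a) = (f \<circ> e)(x := f a)" by auto
    ultimately show ?thesis using Exi.IH[of "e(x := a)"] by metis
  qed
  moreover have "pverts H = f ` pverts G" using f by (simp add: isomorphism_def bij_betw_def)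
  ultimately show ?case by (simp only: sat.simps ball_simps bex_simps cong: bex_cong ball_cong)
next
  case (All x \<phi>)
  have "sat G (e(x := a)) \<phi> \<longleftrightarrow> sat H ((f \<circ> e)(x := f a)) \<phi>" if "a \<in> pverts G" for a
  proof -
    have "range (e(x := a)) \<subseteq> pverts G" using All.prems that by auto
    moreover have "f \<circ> e(x := a) = (f \<circ> e)(x := f a)" by auto
    ultimately show ?thesis using All.IH[of "e(x := a)"] by metis
  qed
  moreover have "pverts H = f ` pverts G" using f by (simp add: isomorphism_def bij_betw_def)
  ultimately show ?case by (simp only: sat.simps ball_simps bex_simps cong: bex_cong ball_cong)
qed simp_all

lemma models_isomorphic:
  assumes "isomorphic G H" "free_vars \<phi> = {}" "pverts G \<noteq> {}"
  shows "models G \<phi> \<longleftrightarrow> models H \<phi>"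
proof -
  obtain f where f: "isomorphism f G H" using assms by (auto simp: isomorphic_def)
  obtain a where "a \<in> pverts G" using assms by auto
  then have "range (\<lambda>_ :: nat. a) \<subseteq> pverts G" by auto
  then have "sat G (\<lambda>_. a) \<phi> \<longleftrightarrow> sat H (f \<circ> (\<lambda>_. a)) \<phi>"
    by (rule sat_isomorphism[OF f])
  then show ?thesis
    using models_closed[OF assms(2), of G "\<lambda>_. a"] models_closed[OF assms(2), of H "f \<circ> (\<lambda>_. a)"]
    by simp
qed

lemma finite_structure_nat:
  assumes "finite_structure (H :: 'b pair_pre_digraph)"
  shows "\<exists>H' :: nat pair_pre_digraph. finite_structure H' \<and> isomorphic H H'"
proof -
  interpret pair_fin_digraph H using assms by (simp add: finite_structure_def)
  obtain f :: "'b \<Rightarrow> nat" where f: "inj_on f (pverts H)"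
    using finite_imp_inj_to_nat_seg[OF pair_finite_verts] by metis
  let ?H = "\<lparr>pverts = f ` pverts H, parcs = map_prod f f ` parcs H\<rparr>"
  have "pair_wf_digraph ?H"
    using in_arcsD1 in_arcsD2 by (auto simp: pair_wf_digraph_def)
  then have "pair_fin_digraph ?H"
    using pair_finite_verts pair_finite_arcs
    by (simp add: pair_fin_digraph_def pair_fin_digraph_axioms_def)
  then have "finite_structure ?H" using assms by (simp add: finite_structure_def)
  moreover have "(u, v) \<in> parcs H \<longleftrightarrow> (f u, f v) \<in> map_prod f f ` parcs H"
    if "u \<in> pverts H" "v \<in> pverts H" for u v
  proof
    assume "(f u, f v) \<in> map_prod f f ` parcs H"
    then obtain x y where xy: "(x, y) \<in> parcs H" "f u = f x" "f v = f y" by auto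
    have "u = x" by (rule inj_onD[OF f xy(2) that(1) in_arcsD1[OF xy(1)]])
    moreover have "v = y" by (rule inj_onD[OF f xy(3) that(2) in_arcsD2[OF xy(1)]])
    ultimately show "(u, v) \<in> parcs H" using xy by simp
  next
    assume "(u, v) \<in> parcs H"
    then show "(f u, f v) \<in> map_prod f f ` parcs H" by (rule rev_image_eqI) simp
  qed
  then have "isomorphism f H ?H"
    using f by (simp add: isomorphism_def bij_betw_def)
  ultimately show ?thesis unfolding isomorphic_def by blast
qed

lemma fo_defines_any_type:
  fixes H :: "'b pair_pre_digraph"
  assumes "fo_defines \<phi> G" "finite_structure H" "\<not> isomorphic G H"
  shows "distinguishes \<phi> G H"
proof -
  obtain H' :: "nat pair_pre_digraph" where H': "finite_structure H'" "isomorphic H H'"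
    using finite_structure_nat assms(2) by blast
  then have "\<not> isomorphic G H'" using assms(3) isomorphic_sym isomorphic_trans by blast
  then have "distinguishes \<phi> G H'" using assms(1) H' by (simp add: fo_defines_def)
  then show ?thesis
    using models_isomorphic[OF H'(2)] assms(2) by (auto simp: distinguishes_def finite_structure_def)
qed

lemma Nest_finite_nonempty: "finite (Nest \<phi>) \<and> Nest \<phi> \<noteq> {}"
  by (induction \<phi>) auto

end

(*
  Let n = |G| and let H be another graph.  The spoiler first plays a set X in G, chosen greedily so
  that X splits V(G) into at least 2|X| + 1 types while no further vertex of a non-singleton type
  splits anything.  Then |X| <= (n - 1)/2, and with the remaining three or more rounds he forces H to
  have the same vertex labels (type over X together with the adjacencies to the vertices of unique
  type) as G, adjacency being a function of the labels.  So H can differ from G only in the sizes of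
  label classes; if two classes competed, the smaller could be counted within (n + 5)/2 rounds.
  Hence only the largest class differs, it consists of twins, and sigma(G) and sigma(H) differ.  The
  spoiler now plays one more twin than the other graph can match: sigma(H) + 1 vertices of G, or
  sigma(G) + 1 vertices of H, and then a vertex telling two of the answers apart.  In the latter case
  that last round is superfluous if the largest class of G is a maximal homogeneous set of more than
  (n + 1)/2 vertices, and its variable can be reused when only the number of variables counts.
  The lower bounds come from adding one twin to the largest class of G.
*)

theory Submission
  imports Defs
begin

section \<open>Similarity classes\<close>

text \<open>Origin of (n + 5)/2: at least 2|X| + 1 types are realized, so two label classes of
  different types have together at most n + 1 - 2|X| vertices, and the smaller has t <= (n + 1)/2 -
  |X|. Playing X, then t + 1 vertices of a class to overfill its counterpart, then one vertex to
  certify labels takes |X| + t + 2 <= (n + 5)/2 rounds. Types alone cannot serve as labels. A vertex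
  whose type is already unique may split a class, but playing it creates only one new type, so the
  greedy choice cannot afford it. Labels record the adjacency to such vertices without playing them;
  testing one of them costs a single round, and only when it is used. A single alternation suffices
  because X is played in G, after which the spoiler either stays in G or moves to H for good. Every
  deduction about H is therefore made from two games without alternations, one in each graph. The
  lower bounds hold without any restriction on alternations and hence apply to both depth
  parameters.\<close>

lemma finite_graph_iff:
  "finite_graph G \<longleftrightarrow> finite (pverts G) \<and> pverts G \<noteq> {} \<and>
     (\<forall>u v. (u, v) \<in> parcs G \<longrightarrow>
        u \<in> pverts G \<and> v \<in> pverts G \<and> u \<noteq> v \<and> (v, u) \<in> parcs G)" (is "_ \<longleftrightarrow> ?R")
proof
  assume "finite_graph G"
  then interpret pair_graph G by (simp add: finite_graph_def)
  show ?R
    using \<open>finite_graph G\<close> pair_finite_verts in_arcsD1 in_arcsD2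
      pair_no_loops[of "(_, _)"] symD[OF pair_sym_arcs[unfolded symmetric_def]]
    by (auto simp: finite_graph_def)
next
  assume R: ?R
  then have "parcs G \<subseteq> pverts G \<times> pverts G" by auto
  then have "finite (parcs G)" by (rule finite_subset) (use R in simp)
  moreover have "symmetric (with_proj G)" using R
    by (auto simp: symmetric_def sym_def arcs_ends_def arc_to_ends_def with_proj_def)
  ultimately have "pair_graph G" using R
    by unfold_locales auto
  then show "finite_graph G" using R by (simp add: finite_graph_def)
qed

lemma finite_graphD:
  assumes "finite_graph G"
  shows "finite (pverts G)" "pverts G \<noteq> {}"
    "(u, v) \<in> parcs G \<Longrightarrow> u \<in> pverts G" "(u, v) \<in> parcs G \<Longrightarrow> v \<in> pverts G"
    "(u, u) \<notin> parcs G" "(u, v) \<in> parcs G \<longleftrightarrow> (v, u) \<in> parcs G"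
  using assms by (auto simp: finite_graph_iff)

text \<open>Only third vertices are constrained: a transposition maps the pair of \<open>x\<close>
  and \<open>y\<close> to itself, and adjacency is symmetric and loopless.\<close>

definition similar :: "'a pair_pre_digraph \<Rightarrow> 'a \<Rightarrow> 'a \<Rightarrow> bool" where
  "similar G x y \<longleftrightarrow> x \<in> pverts G \<and> y \<in> pverts G \<and>
     (\<forall>w\<in>pverts G. w \<noteq> x \<longrightarrow> w \<noteq> y \<longrightarrow> ((w, x) \<in> parcs G \<longleftrightarrow> (w, y) \<in> parcs G))"

lemma similarity_iff:
  assumes G: "finite_graph G"
  shows "(x, y) \<in> similarity G \<longleftrightarrow> similar G x y"
proof
  assume xy: "(x, y) \<in> similarity G"
  then have V: "x \<in> pverts G" "y \<in> pverts G" and iso: "isomorphism (transpose x y) G G"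
    by (auto simp: similarity_def)
  have "(w, x) \<in> parcs G \<longleftrightarrow> (w, y) \<in> parcs G" if "w \<in> pverts G" "w \<noteq> x" "w \<noteq> y" for w
  proof -
    have "(w, x) \<in> parcs G \<longleftrightarrow> (transpose x y w, transpose x y x) \<in> parcs G"
      using iso that V unfolding isomorphism_def by blast
    then show ?thesis using that by simp
  qed
  then show "similar G x y" using V by (simp add: similar_def)
next
  assume s: "similar G x y"
  then have V: "x \<in> pverts G" "y \<in> pverts G" by (auto simp: similar_def)
  have "bij_betw (transpose x y) (pverts G) (pverts G)"
    unfolding bij_betw_def using V
    by (auto simp: transpose_image_eq intro: inj_on_inverseI[of _ "transpose x y"])
  moreover have s': "(w, x) \<in> parcs G \<longleftrightarrow> (w, y) \<in> parcs G" "(x, w) \<in> parcs G \<longleftrightarrow> (y, w) \<in> parcs G"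
    if "w \<in> pverts G" "w \<noteq> x" "w \<noteq> y" for w
    using s that finite_graphD(6)[OF G, of x w] finite_graphD(6)[OF G, of y w]
    unfolding similar_def by blast+
  have "(u, v) \<in> parcs G \<longleftrightarrow> (transpose x y u, transpose x y v) \<in> parcs G"
    if "u \<in> pverts G" "v \<in> pverts G" for u v
  proof -
    consider "u \<in> {x, y}" "v \<in> {x, y}" | "u \<in> {x, y}" "v \<notin> {x, y}"
      | "u \<notin> {x, y}" "v \<in> {x, y}" | "u \<notin> {x, y}" "v \<notin> {x, y}" by blast
    then show ?thesis
    proof cases
      case 1
      then show ?thesis using finite_graphD(5)[OF G] finite_graphD(6)[OF G, of x y] by auto
    qed (use s'[OF that(1)] s'[OF that(2)] in auto)
  qed
  ultimately show "(x, y) \<in> similarity G"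
    using V by (simp add: similarity_def isomorphism_def)
qed

lemma sim_class_eq: "finite_graph G \<Longrightarrow> sim_class G x = {y. similar G x y}"
  by (auto simp: sim_class_def similarity_iff)

lemma similar_refl: "x \<in> pverts G \<Longrightarrow> similar G x x"
  by (simp add: similar_def)

lemma similar_sym: "similar G x y \<Longrightarrow> similar G y x"
  by (auto simp: similar_def)

lemma similar_trans:
  assumes G: "finite_graph G" and xy: "similar G x y" and yz: "similar G y z"
  shows "similar G x z"
proof (cases "x = y \<or> y = z \<or> x = z")
  case True
  then show ?thesis using xy yz by (auto simp: similar_def)
next
  case False
  have V: "x \<in> pverts G" "y \<in> pverts G" "z \<in> pverts G" using xy yz by (auto simp: similar_def)
  have "(w, x) \<in> parcs G \<longleftrightarrow> (w, z) \<in> parcs G" if w: "w \<in> pverts G" "w \<noteq> x" "w \<noteq> z" for w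
  proof (cases "w = y")
    case True
    \<comment> \<open>For the middle vertex the adjacency is carried around the triangle:
      \<open>x\<close> does not separate the twins \<open>y\<close> and \<open>z\<close>, and
      \<open>z\<close> does not separate \<open>x\<close> and \<open>y\<close>.\<close>
    have "(y, x) \<in> parcs G \<longleftrightarrow> (x, z) \<in> parcs G"
      using yz V False finite_graphD(6)[OF G, of x y] by (auto simp: similar_def)
    also have "\<dots> \<longleftrightarrow> (y, z) \<in> parcs G"
      using xy V False finite_graphD(6)[OF G, of x z] finite_graphD(6)[OF G, of y z]
      by (auto simp: similar_def)
    finally show ?thesis using True by simp
  next
    case False
    then show ?thesis using xy yz w by (auto simp: similar_def)
  qed
  then show ?thesis using V by (simp add: similar_def)
qed

text \<open>Two pairs with a common vertex agree because their other ends are twins; disjoint pairs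
  are compared through a pair that meets both.\<close>

lemma similar_homogeneous:
  assumes G: "finite_graph G" and A: "\<And>x y. x \<in> A \<Longrightarrow> y \<in> A \<Longrightarrow> similar G x y"
  shows "homogeneous G A"
proof -
  have V: "A \<subseteq> pverts G" using A by (auto simp: similar_def)
  have one: "(a, b) \<in> parcs G \<longleftrightarrow> (a, c) \<in> parcs G"
    if "a \<in> A" "b \<in> A" "c \<in> A" "b \<noteq> a" "c \<noteq> a" for a b c
  proof -
    have "similar G b c" "a \<in> pverts G" using A that V by auto
    then show ?thesis using that by (auto simp: similar_def)
  qed
  have "(a, b) \<in> parcs G \<longleftrightarrow> (c, d) \<in> parcs G"
    if "a \<in> A" "b \<in> A" "c \<in> A" "d \<in> A" "b \<noteq> a" "d \<noteq> c" for a b c d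
  proof (cases "d = a")
    case True
    then show ?thesis
      using one[of a b c] that finite_graphD(6)[OF G, of a c] by blast
  next
    case False
    then show ?thesis
      using one[of a b d] one[of d a c] that finite_graphD(6)[OF G, of a d]
        finite_graphD(6)[OF G, of c d] by blast
  qed
  then show ?thesis using V unfolding homogeneous_def by metis
qed

lemma sim_class_card_le_sigma:
  assumes "finite_graph G" "x \<in> pverts G"
  shows "card (sim_class G x) \<le> sigma G"
  unfolding sigma_def using assms finite_graphD(1) by (intro Max_ge) auto

lemma sim_class_subset: "finite_graph G \<Longrightarrow> sim_class G x \<subseteq> pverts G"
  by (auto simp: sim_class_eq similar_def)

lemma similar_card_le_sigma:
  assumes G: "finite_graph G" and A: "\<And>x y. x \<in> A \<Longrightarrow> y \<in> A \<Longrightarrow> similar G x y"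
  shows "card A \<le> sigma G"
proof (cases "A = {}")
  case False
  then obtain x where x: "x \<in> A" by blast
  then have V: "x \<in> pverts G" using A by (auto simp: similar_def)
  have "A \<subseteq> sim_class G x" using A x by (auto simp: sim_class_eq[OF G])
  then have "card A \<le> card (sim_class G x)"
    using sim_class_subset[OF G] finite_graphD(1)[OF G] by (meson card_mono finite_subset)
  then show ?thesis using sim_class_card_le_sigma[OF G V] by simp
qed simp

lemma obtain_largest_class:
  assumes G: "finite_graph G"
  obtains u where "u \<in> pverts G" "card (sim_class G u) = sigma G"
proof -
  have "sigma G \<in> (\<lambda>u. card (sim_class G u)) ` pverts G"
    unfolding sigma_def using finite_graphD(1,2)[OF G] by (intro Max_in) auto
  then show ?thesis using that by auto
qed

lemma sim_class_similar:
  "finite_graph G \<Longrightarrow> x \<in> sim_class G u \<Longrightarrow> y \<in> sim_class G u \<Longrightarrow> similar G x y"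
  using similar_trans[of G x u y] similar_sym[of G u x] by (simp add: sim_class_eq)

text \<open>Serves to replace a constructed graph by a copy on the natural numbers, the graphs over
  which \<open>width\<close> takes its supremum.\<close>

lemma isomorphic_finite_graph:
  assumes G: "finite_graph G" and H: "finite_structure H" and "isomorphic G H"
  shows "finite_graph H"
proof -
  obtain f where f: "bij_betw f (pverts G) (pverts H)"
      "\<And>u v. u \<in> pverts G \<Longrightarrow> v \<in> pverts G \<Longrightarrow> (u, v) \<in> parcs G \<longleftrightarrow> (f u, f v) \<in> parcs H"
    using assms by (auto simp: isomorphic_def isomorphism_def)
  interpret H: pair_fin_digraph H using H by (simp add: finite_structure_def)
  have "u \<noteq> v \<and> (v, u) \<in> parcs H" if "(u, v) \<in> parcs H" for u v
  proof -
    have "u \<in> f ` pverts G" "v \<in> f ` pverts G"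
      using that H.in_arcsD1 H.in_arcsD2 f(1) by (auto simp: bij_betw_def)
    then obtain x y where xy: "u = f x" "v = f y" "x \<in> pverts G" "y \<in> pverts G" by blast
    then have "(x, y) \<in> parcs G" using f(2) that by blast
    then have "(y, x) \<in> parcs G" "x \<noteq> y"
      using finite_graphD(5)[OF G] finite_graphD(6)[OF G, of x y] by auto
    then show ?thesis using xy f by (auto simp: bij_betw_def inj_on_eq_iff)
  qed
  then show ?thesis
    using H H.pair_finite_verts H.in_arcsD1 H.in_arcsD2
    by (auto simp: finite_graph_iff finite_structure_def)
qed

lemma finite_graph_finite_structure: "finite_graph G \<Longrightarrow> finite_structure G"
  by (simp add: finite_graph_def finite_structure_def pair_graph_def pair_digraph_def)

section \<open>Ehrenfeucht games with boundedly many alternations\<close>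

text \<open>A position is the set of pairs of vertices chosen so far.  The spoiler moves in the first
  structure while the current quantifier is \<open>QEx\<close> and in the second one while it is \<open>QAll\<close>;
  he may switch at most \<open>k\<close> times.\<close>

definition partial_iso :: "'a pair_pre_digraph \<Rightarrow> 'b pair_pre_digraph \<Rightarrow> ('a \<times> 'b) set \<Rightarrow> bool" where
  "partial_iso G H P \<longleftrightarrow> (\<forall>(a, b)\<in>P. \<forall>(a', b')\<in>P.
     (a = a' \<longleftrightarrow> b = b') \<and> ((a, a') \<in> parcs G \<longleftrightarrow> (b, b') \<in> parcs H))"

lemma partial_isoD:
  assumes "partial_iso G H P" "(a, b) \<in> P" "(a', b') \<in> P"
  shows "a = a' \<longleftrightarrow> b = b'" "(a, a') \<in> parcs G \<longleftrightarrow> (b, b') \<in> parcs H"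
  using assms unfolding partial_iso_def by fast+

definition move :: "quantifier \<Rightarrow> 'a set \<Rightarrow> 'b set \<Rightarrow> ('a \<Rightarrow> 'b \<Rightarrow> bool) \<Rightarrow> bool" where
  "move q A B R \<longleftrightarrow>
     (case q of QEx \<Rightarrow> \<forall>a\<in>A. \<exists>b\<in>B. R a b | QAll \<Rightarrow> \<forall>b\<in>B. \<exists>a\<in>A. R a b)"

text \<open>True when the duplicator survives, so the spoiler's options are joined by conjunction.
  Switching structures costs a unit of \<open>k\<close> but no round.\<close>

fun game :: "nat \<Rightarrow> quantifier \<Rightarrow> 'a pair_pre_digraph \<Rightarrow> 'b pair_pre_digraph \<Rightarrow> nat \<Rightarrow>
    ('a \<times> 'b) set \<Rightarrow> bool" where
  "game k q G H 0 P \<longleftrightarrow> partial_iso G H P"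
| "game 0 q G H (Suc r) P \<longleftrightarrow>
     move q (pverts G) (pverts H) (\<lambda>a b. game 0 q G H r (insert (a, b) P))"
| "game (Suc k) q G H (Suc r) P \<longleftrightarrow>
     move q (pverts G) (pverts H) (\<lambda>a b. game (Suc k) q G H r (insert (a, b) P)) \<and>
     game k (dual q) G H (Suc r) P"

lemma game_move:
  "game k q G H (Suc r) P \<Longrightarrow>
     move q (pverts G) (pverts H) (\<lambda>a b. game k q G H r (insert (a, b) P))"
  by (cases k) auto

lemma game_QEx:
  "game k QEx G H (Suc r) P \<Longrightarrow> a \<in> pverts G \<Longrightarrow>
     \<exists>b\<in>pverts H. game k QEx G H r (insert (a, b) P)"
  using game_move by (fastforce simp: move_def)

lemma game_switch: "game (Suc k) q G H r P \<Longrightarrow> game k (dual q) G H r P"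
  by (cases r) auto

lemma partial_iso_swap: "partial_iso H G (prod.swap ` P) \<longleftrightarrow> partial_iso G H P"
  unfolding partial_iso_def by fastforce

lemma move_swap: "move (dual q) B A (\<lambda>b a. R a b) \<longleftrightarrow> move q A B R"
  by (cases q) (auto simp: move_def)

text \<open>Allows every strategy to be described for a spoiler who moves in the first
  structure.\<close>

lemma game_swap: "game k q G H r P \<Longrightarrow> game k (dual q) H G r (prod.swap ` P)"
proof (induction k q G H r P rule: game.induct)
  case (1 k q G H P)
  then show ?case by (simp add: partial_iso_swap)
next
  case (2 q G H r P)
  then show ?case
    by (subst game.simps(2), subst move_swap[symmetric], cases q)
      (fastforce simp: move_def)+
next
  case (3 k q G H r P)
  then show ?case
    by (subst game.simps(3), subst move_swap[symmetric], cases q)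
      (fastforce simp: move_def)+
qed

lemma game_swap_initial: "game k QAll G H r {} \<Longrightarrow> game k QEx H G r {}"
  using game_swap[of k QAll G H r "{}"] by (simp del: game.simps)

lemma move_mono: "move q A B R \<Longrightarrow> (\<And>a b. R a b \<Longrightarrow> S a b) \<Longrightarrow> move q A B S"
  by (cases q) (fastforce simp: move_def)+

lemma game_less_alternations: "game (Suc k) q G H r P \<Longrightarrow> game k q G H r P"
proof (induction k q G H r P rule: game.induct)
  case (2 q G H r P)
  show ?case
    unfolding game.simps(2) by (rule move_mono[OF game_move[OF "2.prems"]]) (rule "2.IH")
next
  case (3 k q G H r P)
  have "game k (dual q) G H (Suc r) P" by (rule "3.IH"(2)[OF game_switch[OF "3.prems"]])
  moreover have "move q (pverts G) (pverts H) (\<lambda>a b. game (Suc k) q G H r (insert (a, b) P))"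
    by (rule move_mono[OF game_move[OF "3.prems"]]) (rule "3.IH"(1))
  ultimately show ?case by simp
qed simp

text \<open>A nonempty universe gives the spoiler some move; once it has been answered, the extra
  pair is forgotten.\<close>

lemma game_fewer_rounds:
  "pverts G \<noteq> {} \<Longrightarrow> pverts H \<noteq> {} \<Longrightarrow> game k q G H (Suc r) P \<Longrightarrow> game k q G H r P"
proof (induction k q G H r P rule: game.induct)
  case (1 k q G H P)
  have "\<exists>a b. partial_iso G H (insert (a, b) P)"
  proof (cases q)
    case QEx
    then show ?thesis using game_move[OF "1"(3)] "1"(1,2) by (simp add: move_def) blast
  next
    case QAll
    then show ?thesis using game_move[OF "1"(3)] "1"(1,2) by (simp add: move_def) blast
  qed
  then show ?case by (auto simp: partial_iso_def)
next
  case (2 q G H r P)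
  show ?case
    unfolding game.simps(2) by (rule move_mono[OF game_move[OF "2.prems"(3)]]) (rule "2.IH"[OF "2.prems"(1,2)])
next
  case (3 k q G H r P)
  have "game k (dual q) G H (Suc r) P" by (rule "3.IH"(2)[OF "3.prems"(1,2) game_switch[OF "3.prems"(3)]])
  moreover have "move q (pverts G) (pverts H) (\<lambda>a b. game (Suc k) q G H r (insert (a, b) P))"
    by (rule move_mono[OF game_move[OF "3.prems"(3)]]) (rule "3.IH"(1)[OF "3.prems"(1,2)])
  ultimately show ?case by simp
qed

lemma game_partial_iso:
  assumes "pverts G \<noteq> {}" "pverts H \<noteq> {}"
  shows "game k q G H r P \<Longrightarrow> partial_iso G H P"
  by (induction r) (auto dest: game_fewer_rounds[OF assms])

lemma game_anti_rounds:
  assumes "pverts G \<noteq> {}" "pverts H \<noteq> {}"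
  shows "r \<le> s \<Longrightarrow> game k q G H s P \<Longrightarrow> game k q G H r P"
  by (induction s rule: dec_induct) (auto dest: game_fewer_rounds[OF assms])

text \<open>The spoiler plays a whole set without alternating, and \<open>k\<close> stays intact.
  That the answers \<open>f\<close> are injective is read off from \<open>partial_iso\<close> where
  it matters.\<close>

lemma game_QEx_moves:
  assumes "finite A" "A \<subseteq> pverts G" "card A \<le> r" "game k QEx G H r P"
  shows "\<exists>f. f ` A \<subseteq> pverts H \<and> game k QEx G H (r - card A) (P \<union> (\<lambda>a. (a, f a)) ` A)"
  using assms
proof (induction A rule: finite_induct)
  case empty
  then show ?case by simp
next
  case (insert a A)
  then obtain f where f: "f ` A \<subseteq> pverts H"
      "game k QEx G H (r - card A) (P \<union> (\<lambda>a. (a, f a)) ` A)" by auto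
  have "r - card A = Suc (r - card (insert a A))" using insert by simp
  then obtain b where b: "b \<in> pverts H"
      "game k QEx G H (r - card (insert a A)) (insert (a, b) (P \<union> (\<lambda>a. (a, f a)) ` A))"
    using game_QEx[of k G H "r - card (insert a A)" "P \<union> (\<lambda>a. (a, f a)) ` A" a] f insert.prems
    by auto
  have eq: "P \<union> (\<lambda>c. (c, (f(a := b)) c)) ` insert a A = insert (a, b) (P \<union> (\<lambda>a. (a, f a)) ` A)"
    using insert.hyps by (auto simp: image_iff)
  show ?case
    by (rule exI[of _ "f(a := b)"]) (use f b insert.hyps eq in auto)
qed

section \<open>Formulas describing games\<close>

text \<open>The empty conjunction is \<open>Eq 1 1\<close>, for want of a closed true formula without quantifiers.\<close>

fun conjs :: "fm list \<Rightarrow> fm" where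
  "conjs [] = Eq 1 1"
| "conjs [\<phi>] = \<phi>"
| "conjs (\<phi> # \<psi> # \<Phi>) = Conj \<phi> (conjs (\<psi> # \<Phi>))"

text \<open>The De Morgan form inherits its properties from \<open>conjs\<close>; the two negations
  dualize \<open>Nest\<close> twice and leave it unchanged.\<close>

definition disjs :: "fm list \<Rightarrow> fm" where
  "disjs \<Phi> = Neg (conjs (map Neg \<Phi>))"

definition lit :: "bool \<Rightarrow> fm \<Rightarrow> fm" where
  "lit b \<phi> = (if b then \<phi> else Neg \<phi>)"

lemma sat_conjs [simp]: "sat G e (conjs \<Phi>) \<longleftrightarrow> (\<forall>\<phi>\<in>set \<Phi>. sat G e \<phi>)"
  by (induction \<Phi> rule: conjs.induct) auto

lemma Nest_conjs [simp]: "\<Phi> \<noteq> [] \<Longrightarrow> Nest (conjs \<Phi>) = (\<Union>\<phi>\<in>set \<Phi>. Nest \<phi>)"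
  by (induction \<Phi> rule: conjs.induct) auto

lemma vars_conjs [simp]: "\<Phi> \<noteq> [] \<Longrightarrow> vars (conjs \<Phi>) = (\<Union>\<phi>\<in>set \<Phi>. vars \<phi>)"
  by (induction \<Phi> rule: conjs.induct) auto

lemma free_vars_conjs [simp]: "\<Phi> \<noteq> [] \<Longrightarrow> free_vars (conjs \<Phi>) = (\<Union>\<phi>\<in>set \<Phi>. free_vars \<phi>)"
  by (induction \<Phi> rule: conjs.induct) auto

lemma map_dual_map_dual [simp]: "map dual (map dual w) = w"
proof -
  have "dual (dual q) = q" for q by (cases q) auto
  then show ?thesis by (simp add: comp_def)
qed

lemma disjs_simps [simp]:
  "sat G e (disjs \<Phi>) \<longleftrightarrow> (\<exists>\<phi>\<in>set \<Phi>. sat G e \<phi>)"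
  "\<Phi> \<noteq> [] \<Longrightarrow> Nest (disjs \<Phi>) = (\<Union>\<phi>\<in>set \<Phi>. Nest \<phi>)"
  "\<Phi> \<noteq> [] \<Longrightarrow> vars (disjs \<Phi>) = (\<Union>\<phi>\<in>set \<Phi>. vars \<phi>)"
  "\<Phi> \<noteq> [] \<Longrightarrow> free_vars (disjs \<Phi>) = (\<Union>\<phi>\<in>set \<Phi>. free_vars \<phi>)"
  by (auto simp: disjs_def image_UN image_image simp del: map_map)

lemma lit_simps [simp]:
  "sat G e (lit b \<phi>) \<longleftrightarrow> (b \<longleftrightarrow> sat G e \<phi>)"
  "vars (lit b \<phi>) = vars \<phi>" "free_vars (lit b \<phi>) = free_vars \<phi>"
  by (auto simp: lit_def)

lemma Nest_lit [simp]: "Nest \<phi> = {[]} \<Longrightarrow> Nest (lit b \<phi>) = {[]}"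
  by (simp add: lit_def)

definition vertex_list :: "'a pair_pre_digraph \<Rightarrow> 'a list" where
  "vertex_list G = (SOME xs. set xs = pverts G)"

lemma set_vertex_list [simp]: "finite (pverts G) \<Longrightarrow> set (vertex_list G) = pverts G"
  unfolding vertex_list_def by (rule someI_ex) (rule finite_list)

text \<open>The shift by \<open>Suc\<close> makes the variables start at 1, as in the variable sets
  of \<open>width_dist\<close>.\<close>

definition diagram :: "'a pair_pre_digraph \<Rightarrow> 'a list \<Rightarrow> fm" where
  "diagram G as = conjs (concat (map (\<lambda>i. concat (map (\<lambda>j.
     [lit (as ! i = as ! j) (Eq (Suc i) (Suc j)), lit ((as ! i, as ! j) \<in> parcs G) (Adj (Suc i) (Suc j))])
     [0..<length as])) [0..<length as]))"

text \<open>One level of a one-sided Hintikka formula: either every vertex of \<open>G\<close> has a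
  counterpart, or every vertex of the other structure is one.\<close>

definition step :: "quantifier \<Rightarrow> 'a pair_pre_digraph \<Rightarrow> nat \<Rightarrow> ('a \<Rightarrow> fm) \<Rightarrow> fm" where
  "step q G x F = (case q of
       QEx \<Rightarrow> conjs (map (\<lambda>a. Exi x (F a)) (vertex_list G))
     | QAll \<Rightarrow> All x (disjs (map F (vertex_list G))))"

text \<open>The strongest formula, true of the tuple \<open>as\<close> in \<open>G\<close>, whose nested quantifier sequences
  have length \<open>r\<close>, begin with \<open>q\<close> and alternate at most \<open>k\<close> times (a missing block of
  \<open>q\<close> counting as an alternation).  Its free variables \<open>1, \<dots>, length as\<close> stand for \<open>as\<close>.\<close>

fun game_formula :: "nat \<Rightarrow> quantifier \<Rightarrow> 'a pair_pre_digraph \<Rightarrow> nat \<Rightarrow> 'a list \<Rightarrow> fm" where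
  "game_formula k q G 0 as = diagram G as"
| "game_formula 0 q G (Suc r) as =
     step q G (Suc (length as)) (\<lambda>a. game_formula 0 q G r (as @ [a]))"
| "game_formula (Suc k) q G (Suc r) as =
     Conj (step q G (Suc (length as)) (\<lambda>a. game_formula (Suc k) q G r (as @ [a])))
       (game_formula k (dual q) G (Suc r) as)"

definition position :: "'a list \<Rightarrow> (nat \<Rightarrow> 'b) \<Rightarrow> ('a \<times> 'b) set" where
  "position as e = (\<lambda>i. (as ! i, e (Suc i))) ` {..<length as}"

lemma position_snoc:
  "position (as @ [a]) (e(Suc (length as) := b)) = insert (a, b) (position as e)"
  unfolding position_def by (force simp: nth_append image_iff less_Suc_eq)

lemma sat_diagram: "sat H e (diagram G as) \<longleftrightarrow> partial_iso G H (position as e)"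
  by (auto simp: diagram_def partial_iso_def position_def)

lemma sat_step:
  assumes "finite (pverts G)"
  shows "sat H e (step q G x F) \<longleftrightarrow> move q (pverts G) (pverts H) (\<lambda>a b. sat H (e(x := b)) (F a))"
  using assms by (cases q) (auto simp: step_def move_def)

lemma sat_game_formula:
  "finite (pverts G) \<Longrightarrow> sat H e (game_formula k q G r as) \<longleftrightarrow> game k q G H r (position as e)"
  by (induction k q G r as arbitrary: e rule: game_formula.induct)
    (simp_all add: sat_diagram sat_step position_snoc)

lemma diagram_simps:
  assumes "as \<noteq> []"
  shows "Nest (diagram G as) = {[]}" "vars (diagram G as) = {1..length as}"
    "free_vars (diagram G as) = {1..length as}"
proof -
  let ?L = "concat (map (\<lambda>i. concat (map (\<lambda>j.
     [lit (as ! i = as ! j) (Eq (Suc i) (Suc j)), lit ((as ! i, as ! j) \<in> parcs G) (Adj (Suc i) (Suc j))])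
     [0..<length as])) [0..<length as])"
  have ne: "?L \<noteq> []" using assms by (auto simp: concat_eq_Nil_conv)
  have I: "{1..length as} = Suc ` {..<length as}" by (simp add: image_Suc_lessThan)
  show "Nest (diagram G as) = {[]}"
    unfolding diagram_def Nest_conjs[OF ne] using assms by (auto simp: lessThan_empty_iff)
  show "vars (diagram G as) = {1..length as}" "free_vars (diagram G as) = {1..length as}"
    unfolding diagram_def vars_conjs[OF ne] free_vars_conjs[OF ne] I by auto
qed

lemma step_simps:
  assumes "finite (pverts G)" "pverts G \<noteq> {}"
  shows "Nest (step q G x F) = (\<Union>a\<in>pverts G. (#) q ` Nest (F a))"
    "vars (step q G x F) = insert x (\<Union>a\<in>pverts G. vars (F a))"
    "free_vars (step q G x F) = (\<Union>a\<in>pverts G. free_vars (F a)) - {x}"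
proof -
  have "vertex_list G \<noteq> []" using assms by (metis set_empty set_vertex_list)
  then show "Nest (step q G x F) = (\<Union>a\<in>pverts G. (#) q ` Nest (F a))"
    "vars (step q G x F) = insert x (\<Union>a\<in>pverts G. vars (F a))"
    "free_vars (step q G x F) = (\<Union>a\<in>pverts G. free_vars (F a)) - {x}"
    using assms by (cases q; auto simp: step_def)+
qed

text \<open>Each round introduces one variable. The condition on \<open>as\<close> and
  \<open>r\<close> excludes the empty diagram, whose placeholder \<open>Eq 1 1\<close> mentions a
  variable.\<close>

lemma vars_game_formula:
  "finite (pverts G) \<Longrightarrow> pverts G \<noteq> {} \<Longrightarrow> as \<noteq> [] \<or> r > 0 \<Longrightarrow>
     vars (game_formula k q G r as) \<subseteq> {1..length as + r}"
proof (induction k q G r as rule: game_formula.induct)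
  case (2 q G r as)
  then have "vars (game_formula 0 q G r (as @ [a])) \<subseteq> {1..length as + Suc r}" for a by fastforce
  then show ?case using "2.prems" by (simp add: step_simps UN_subset_iff)
next
  case (3 k q G r as)
  then have "vars (game_formula (Suc k) q G r (as @ [a])) \<subseteq> {1..length as + Suc r}" for a by fastforce
  then show ?case using 3 by (simp add: step_simps UN_subset_iff)
qed (simp add: diagram_simps)

lemma free_vars_game_formula:
  "finite (pverts G) \<Longrightarrow> pverts G \<noteq> {} \<Longrightarrow> as \<noteq> [] \<or> r > 0 \<Longrightarrow>
     free_vars (game_formula k q G r as) \<subseteq> {1..length as}"
proof (induction k q G r as rule: game_formula.induct)
  case (2 q G r as)
  then have "free_vars (game_formula 0 q G r (as @ [a])) \<subseteq> {1..Suc (length as)}" for a by fastforce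
  then show ?case using "2.prems"
    by (auto simp: step_simps UN_subset_iff atLeastAtMostSuc_conv)
next
  case (3 k q G r as)
  then have "free_vars (game_formula (Suc k) q G r (as @ [a])) \<subseteq> {1..Suc (length as)}" for a by fastforce
  then show ?case using 3
    by (auto simp: step_simps UN_subset_iff atLeastAtMostSuc_conv)
qed (simp add: diagram_simps)

lemma alternations_Cons_Cons:
  "alternations (a # b # w) = (if a = b then 0 else 1) + alternations (b # w)"
proof -
  let ?S = "\<lambda>w :: quantifier list. {i. Suc i < length w \<and> w ! i \<noteq> w ! Suc i}"
  have fin: "finite (?S w)" for w by (rule finite_subset[of _ "{..<length w}"]) auto
  have "i \<in> ?S (a # b # w) \<longleftrightarrow> i \<in> (if a = b then {} else {0}) \<union> Suc ` ?S (b # w)" for i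
    by (cases i) auto
  then have "?S (a # b # w) = (if a = b then {} else {0}) \<union> Suc ` ?S (b # w)" by blast
  then show ?thesis
    using fin by (auto simp: alternations_def card_insert_if card_image)
qed

lemma alternations_short [simp]: "alternations [] = 0" "alternations [a] = 0"
  by (simp_all add: alternations_def)

text \<open>Counting alternations of \<open>q # w\<close> keeps the induction going: a switch lowers
  \<open>k\<close> by one and dualizes the prepended letter, which changes the count by at most
  one.\<close>

lemma Nest_game_formula:
  "finite (pverts G) \<Longrightarrow> pverts G \<noteq> {} \<Longrightarrow> as \<noteq> [] \<or> r > 0 \<Longrightarrow>
     w \<in> Nest (game_formula k q G r as) \<Longrightarrow> length w = r \<and> alternations (q # w) \<le> k"
proof (induction k q G r as arbitrary: w rule: game_formula.induct)
  case (2 q G r as)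
  then obtain a w' where "w = q # w'" "w' \<in> Nest (game_formula 0 q G r (as @ [a]))"
    by (auto simp: step_simps)
  then show ?case using "2.IH"[of a w'] "2.prems" by (simp add: alternations_Cons_Cons)
next
  case (3 k q G r as)
  then consider a w' where "w = q # w'" "w' \<in> Nest (game_formula (Suc k) q G r (as @ [a]))"
    | "w \<in> Nest (game_formula k (dual q) G (Suc r) as)"
    by (auto simp: step_simps)
  then show ?case
  proof cases
    case 1
    then show ?thesis using "3.IH"(1)[of a w'] "3.prems" by (simp add: alternations_Cons_Cons)
  next
    case 2
    then have "length w = Suc r" "alternations (dual q # w) \<le> k"
      using "3.IH"(2)[of w] "3.prems" by auto
    then show ?thesis by (cases w) (auto simp: alternations_Cons_Cons split: if_splits)
  qed
qed (simp add: diagram_simps)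

lemma alternations_tl: "alternations w \<le> alternations (q # w)"
  by (cases w) (auto simp: alternations_Cons_Cons)

section \<open>From lost games to upper bounds on depth and number of variables\<close>

lemma game_refl: "P \<subseteq> Id \<Longrightarrow> game k q G G r P"
proof (induction k q G G r P rule: game.induct)
  case (1 k q G P)
  then show ?case by (auto simp: partial_iso_def)
next
  case (2 q G r P)
  then show ?case by (cases q) (auto simp: move_def)
next
  case (3 k q G r P)
  then show ?case by (cases q) (auto simp: move_def)
qed

text \<open>The defining formula conjoins the two game formulas for the two first quantifiers, so
  the spoiler may start in either structure; a conjunction only unites the sets of words and creates
  no alternation.\<close>

lemma depth_alt_le:
  assumes G: "finite_graph G" and r: "r > 0"
    and win: "\<And>H :: nat pair_pre_digraph. finite_structure H \<Longrightarrow>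
      game k QEx G H r {} \<Longrightarrow> game k QAll G H r {} \<Longrightarrow> isomorphic G H"
  shows "depth_alt k G \<le> enat r"
proof -
  let ?\<phi> = "Conj (game_formula k QEx G r []) (game_formula k QAll G r [])"
  have fin: "finite (pverts G)" "pverts G \<noteq> {}" using finite_graphD[OF G] by auto
  have nest: "length w = r \<and> alternations w \<le> k" if w: "w \<in> Nest ?\<phi>" for w
  proof -
    obtain q where "w \<in> Nest (game_formula k q G r [])" using w by auto
    then have "length w = r" "alternations (q # w) \<le> k"
      using Nest_game_formula[OF fin, of "[]" r w k q] r by auto
    then show ?thesis using alternations_tl[of w q] by simp
  qed
  have ne: "finite (Nest ?\<phi>)" "Nest ?\<phi> \<noteq> {}" using Nest_finite_nonempty by blast+
  have rank: "quantifier_rank ?\<phi> \<le> r" "alternation_number ?\<phi> \<le> k"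
    unfolding quantifier_rank_def alternation_number_def using ne nest by (auto simp: Max_le_iff simp del: Nest.simps)
  have closed: "free_vars ?\<phi> = {}"
    using free_vars_game_formula[OF fin, of "[]" r] r by auto
  have "models G ?\<phi>"
  proof -
    show ?thesis
      by (simp add: game_refl models_def sat_game_formula fin position_def)
  qed
  moreover have "\<not> models H ?\<phi>" if "finite_structure H" "\<not> isomorphic G H" for H :: "nat pair_pre_digraph"
    using win[of H] that by (auto simp: models_def sat_game_formula fin position_def)
  ultimately have "fo_defines ?\<phi> G"
    using closed by (simp add: fo_defines_def distinguishes_def)
  then have "depth_alt k G \<le> enat (quantifier_rank ?\<phi>)"
    unfolding depth_alt_def using rank by (intro INF_lower) simp
  then show ?thesis using rank by (meson enat_ord_simps(1) order_trans)
qed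

lemma depth_le_depth_alt: "depth G \<le> depth_alt k G"
  unfolding depth_def depth_alt_def by (intro INF_superset_mono) auto

lemma width_dist_le:
  assumes G: "finite_graph G" and r: "r > 0" and lose: "\<not> game k q G H r {}"
  shows "width_dist G H \<le> enat r"
proof -
  let ?\<phi> = "game_formula k q G r []"
  have fin: "finite (pverts G)" "pverts G \<noteq> {}" using finite_graphD[OF G] by auto
  have "models G ?\<phi>"
    by (simp add: game_refl models_def sat_game_formula fin position_def)
  moreover have "\<not> models H ?\<phi>"
    using lose by (simp add: models_def sat_game_formula fin position_def)
  moreover have "vars ?\<phi> \<subseteq> {1..r}" "free_vars ?\<phi> = {}"
    using vars_game_formula[OF fin, of "[]" r k q] free_vars_game_formula[OF fin, of "[]" r k q] r
    by auto
  ultimately show ?thesis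
    unfolding width_dist_def distinguishes_def by (intro INF_lower) auto
qed

section \<open>Graphs whose adjacency is determined by vertex labels\<close>

definition fibre :: "'a pair_pre_digraph \<Rightarrow> ('a \<Rightarrow> 'l) \<Rightarrow> 'l \<Rightarrow> 'a set" where
  "fibre G l d = {v \<in> pverts G. l v = d}"

text \<open>One adjacency rule on labels serves both graphs, but only for pairs of labels realized
  by distinct vertices in each of them.\<close>

definition compatible ::
    "'a pair_pre_digraph \<Rightarrow> ('a \<Rightarrow> 'l) \<Rightarrow> 'b pair_pre_digraph \<Rightarrow> ('b \<Rightarrow> 'l) \<Rightarrow> bool" where
  "compatible G l H l' \<longleftrightarrow> finite_graph G \<and> finite_graph H \<and>
     (\<forall>u\<in>pverts G. \<forall>v\<in>pverts G. \<forall>x\<in>pverts H. \<forall>y\<in>pverts H.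
        u \<noteq> v \<longrightarrow> x \<noteq> y \<longrightarrow> l u = l' x \<longrightarrow> l v = l' y \<longrightarrow>
        ((u, v) \<in> parcs G \<longleftrightarrow> (x, y) \<in> parcs H))"

lemma compatible_adj:
  "compatible G l H l' \<Longrightarrow> u \<in> pverts G \<Longrightarrow> v \<in> pverts G \<Longrightarrow> x \<in> pverts H \<Longrightarrow> y \<in> pverts H \<Longrightarrow>
    u \<noteq> v \<Longrightarrow> x \<noteq> y \<Longrightarrow> l u = l' x \<Longrightarrow> l v = l' y \<Longrightarrow> (u, v) \<in> parcs G \<longleftrightarrow> (x, y) \<in> parcs H"
  by (simp add: compatible_def)

lemma compatible_sym: "compatible G l H l' \<Longrightarrow> compatible H l' G l"
  by (simp add: compatible_def)

definition label_embedding ::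
    "('a \<Rightarrow> 'b) \<Rightarrow> 'a pair_pre_digraph \<Rightarrow> ('a \<Rightarrow> 'l) \<Rightarrow> 'b pair_pre_digraph \<Rightarrow> ('b \<Rightarrow> 'l) \<Rightarrow> bool" where
  "label_embedding f G l H l' \<longleftrightarrow>
     inj_on f (pverts G) \<and> (\<forall>v\<in>pverts G. f v \<in> pverts H \<and> l' (f v) = l v)"

lemma label_embedding_exists:
  assumes G: "finite_graph G" and H: "finite_graph H"
    and le: "\<And>d. card (fibre G l d) \<le> card (fibre H l' d)"
  shows "\<exists>f. label_embedding f G l H l'"
proof -
  have "\<exists>g. g ` fibre G l d \<subseteq> fibre H l' d \<and> inj_on g (fibre G l d)" for d
    using card_le_inj[of "fibre G l d" "fibre H l' d"] le finite_graphD(1)[OF G] finite_graphD(1)[OF H]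
    by (auto simp: fibre_def)
  then obtain g where g: "\<And>d. g d ` fibre G l d \<subseteq> fibre H l' d" "\<And>d. inj_on (g d) (fibre G l d)"
    by metis
  have lab: "g (l v) v \<in> pverts H \<and> l' (g (l v) v) = l v" if "v \<in> pverts G" for v
    using that g(1)[of "l v"] by (auto simp: fibre_def)
  moreover have "inj_on (\<lambda>v. g (l v) v) (pverts G)"
  proof (rule inj_onI)
    fix u v assume uv: "u \<in> pverts G" "v \<in> pverts G" and eq: "g (l u) u = g (l v) v"
    then have "l u = l v" using lab[of u] lab[of v] by metis
    then show "u = v" using g(2)[of "l v"] uv eq by (auto simp: fibre_def inj_on_def)
  qed
  ultimately show ?thesis unfolding label_embedding_def by blast
qed

lemma label_embedding_adj:
  assumes c: "compatible G l H l'" and f: "label_embedding f G l H l'"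
    and uv: "u \<in> pverts G" "v \<in> pverts G"
  shows "(u, v) \<in> parcs G \<longleftrightarrow> (f u, f v) \<in> parcs H"
proof (cases "u = v")
  case True
  then show ?thesis using c finite_graphD(5) unfolding compatible_def by metis
next
  case False
  then have "f u \<noteq> f v" using f uv by (auto simp: label_embedding_def inj_on_def)
  then show ?thesis
    using f uv False by (intro compatible_adj[OF c]) (auto simp: label_embedding_def)
qed

lemma label_embedding_onto:
  assumes c: "compatible G l H l'" and f: "label_embedding f G l H l'"
    and y: "y \<in> pverts H" and eq: "card (fibre G l (l' y)) = card (fibre H l' (l' y))"
  shows "y \<in> f ` pverts G"
proof -
  let ?F = "fibre G l (l' y)"
  have "inj_on f ?F"
    by (rule inj_on_subset[of f "pverts G"]) (use f in \<open>auto simp: label_embedding_def fibre_def\<close>)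
  then have "card (f ` ?F) = card (fibre H l' (l' y))" using eq card_image by metis
  moreover have "f ` ?F \<subseteq> fibre H l' (l' y)" using f by (auto simp: label_embedding_def fibre_def)
  moreover have "finite (fibre H l' (l' y))"
    using c finite_graphD(1)[of H] by (simp add: fibre_def compatible_def)
  ultimately have "f ` ?F = fibre H l' (l' y)" by (meson card_subset_eq)
  moreover have "y \<in> fibre H l' (l' y)" using y by (simp add: fibre_def)
  ultimately show ?thesis by (auto simp: fibre_def)
qed

lemma compatible_isomorphic:
  assumes c: "compatible G l H l'" and eq: "\<And>d. card (fibre G l d) = card (fibre H l' d)"
  shows "isomorphic G H"
proof -
  have G: "finite_graph G" and H: "finite_graph H" using c by (auto simp: compatible_def)
  obtain f where f: "label_embedding f G l H l'" using label_embedding_exists[OF G H, of l l'] eq by auto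
  have "y \<in> f ` pverts G" if "y \<in> pverts H" for y
    using label_embedding_onto[OF c f that eq] .
  then have "bij_betw f (pverts G) (pverts H)"
    using f by (auto simp: bij_betw_def label_embedding_def)
  then show ?thesis
    using label_embedding_adj[OF c f] unfolding isomorphic_def isomorphism_def by blast
qed

lemma card_two_obtain_other:
  assumes "2 \<le> card A"
  obtains v where "v \<in> A" "v \<noteq> x"
proof -
  have "\<not> A \<subseteq> {x}"
    using assms card_mono[of "{x}" A] by auto
  then show ?thesis using that by blast
qed

text \<open>The adjacencies of a third vertex \<open>w\<close> to \<open>u\<close> and to
  \<open>v\<close> are both read off from one pair in \<open>H\<close>. Two vertices in the fibre
  are required since the counterpart of \<open>w\<close> may itself carry the label
  \<open>d\<close>.\<close>

lemma same_label_similar: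
  assumes c: "compatible G l H l'" and sub: "l ` pverts G \<subseteq> l' ` pverts H"
    and uv: "u \<in> pverts G" "v \<in> pverts G" "l u = d" "l v = d" and two: "2 \<le> card (fibre H l' d)"
  shows "similar G u v"
proof -
  have "(w, u) \<in> parcs G \<longleftrightarrow> (w, v) \<in> parcs G" if w: "w \<in> pverts G" "w \<noteq> u" "w \<noteq> v" for w
  proof -
    obtain w' where w': "w' \<in> pverts H" "l w = l' w'" using sub w(1) by auto
    obtain v' where v': "v' \<in> fibre H l' d" "v' \<noteq> w'" by (rule card_two_obtain_other[OF two])
    have "(w, u) \<in> parcs G \<longleftrightarrow> (w', v') \<in> parcs H"
      by (rule compatible_adj[OF c]) (use w w' v' uv in \<open>auto simp: fibre_def\<close>)
    moreover have "(w, v) \<in> parcs G \<longleftrightarrow> (w', v') \<in> parcs H"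
      by (rule compatible_adj[OF c]) (use w w' v' uv in \<open>auto simp: fibre_def\<close>)
    ultimately show ?thesis by simp
  qed
  then show ?thesis using uv by (simp add: similar_def)
qed

text \<open>A vertex outside the image of the embedding is a twin of the images of at least two vertices
  of \<open>G\<close>, hence cannot tell apart the images of twins.\<close>

lemma embedding_similar:
  assumes c: "compatible G l H l'" and f: "label_embedding f G l H l'"
    and two: "2 \<le> card (fibre G l d)"
    and labels: "l ` pverts G = l' ` pverts H"
    and out: "\<And>w. w \<in> pverts H \<Longrightarrow> w \<notin> f ` pverts G \<Longrightarrow> l' w = d"
    and xy: "similar G x y"
  shows "similar H (f x) (f y)"
proof -
  have G: "finite_graph G" and H: "finite_graph H" using c by (auto simp: compatible_def)
  have xV: "x \<in> pverts G" "y \<in> pverts G" using xy by (auto simp: similar_def)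
  have fV: "f v \<in> pverts H" "l' (f v) = l v" if "v \<in> pverts G" for v
    using f that by (auto simp: label_embedding_def)
  show ?thesis
  proof (cases "l x = d \<and> l y = d")
    case True
    then show ?thesis
      using same_label_similar[OF compatible_sym[OF c], of "f x" "f y" d] fV xV two labels by simp
  next
    case False
    have "(w, f x) \<in> parcs H \<longleftrightarrow> (w, f y) \<in> parcs H"
      if w: "w \<in> pverts H" "w \<noteq> f x" "w \<noteq> f y" for w
    proof (cases "w \<in> f ` pverts G")
      case True
      then obtain v where v: "v \<in> pverts G" "w = f v" by blast
      then have "(v, x) \<in> parcs G \<longleftrightarrow> (v, y) \<in> parcs G" using xy w by (auto simp: similar_def)
      then show ?thesis using label_embedding_adj[OF c f] v xV by simp
    next
      case out': False
      \<comment> \<open>At most one of \<open>x\<close> and \<open>y\<close> has label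
        \<open>d\<close>, so a vertex of the fibre avoiding that one avoids both.\<close>
      obtain v where v: "v \<in> fibre G l d" "v \<noteq> (if l x = d then x else y)"
        by (rule card_two_obtain_other[OF two])
      then have v': "v \<in> pverts G" "v \<noteq> x" "v \<noteq> y" "l v = d"
        using False by (auto simp: fibre_def split: if_splits)
      have sim: "similar H (f v) w"
        using same_label_similar[OF compatible_sym[OF c], of "f v" w d] fV[of v] v' w out[OF w(1) out'] two labels
        by simp
      have ne: "f v \<noteq> f x" "f v \<noteq> f y" using f v' xV by (auto simp: label_embedding_def inj_on_def)
      have "(f x, f v) \<in> parcs H \<longleftrightarrow> (f x, w) \<in> parcs H" "(f y, f v) \<in> parcs H \<longleftrightarrow> (f y, w) \<in> parcs H"
        using sim w ne fV xV by (auto simp: similar_def)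
      moreover have "(v, x) \<in> parcs G \<longleftrightarrow> (v, y) \<in> parcs G" using xy v' by (auto simp: similar_def)
      then have "(f v, f x) \<in> parcs H \<longleftrightarrow> (f v, f y) \<in> parcs H"
        using label_embedding_adj[OF c f] v' xV by simp
      ultimately show ?thesis
        using finite_graphD(6)[OF H, of w "f x"] finite_graphD(6)[OF H, of w "f y"]
          finite_graphD(6)[OF H, of "f v" "f x"] finite_graphD(6)[OF H, of "f v" "f y"] by blast
    qed
    then show ?thesis using fV xV by (simp add: similar_def)
  qed
qed

text \<open>A class of \<open>G\<close> meeting the larger fibre gains a vertex outside the image of
  \<open>f\<close>. By \<open>rest\<close>, a largest class that avoids the fibre is no larger than
  the class containing the fibre, which grows as well.\<close>

lemma sigma_less:
  assumes c: "compatible G l H l'" and f: "label_embedding f G l H l'"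
    and two: "2 \<le> card (fibre G l d)" and less: "card (fibre G l d) < card (fibre H l' d)"
    and labels: "l ` pverts G = l' ` pverts H"
    and out: "\<And>w. w \<in> pverts H \<Longrightarrow> w \<notin> f ` pverts G \<Longrightarrow> l' w = d"
    and rest: "\<And>A. A \<inter> fibre G l d = {} \<Longrightarrow> (\<And>x y. x \<in> A \<Longrightarrow> y \<in> A \<Longrightarrow> similar G x y) \<Longrightarrow>
      card A \<le> card (fibre G l d)"
  shows "sigma G < sigma H"
proof -
  have G: "finite_graph G" and H: "finite_graph H" using c by (auto simp: compatible_def)
  have fV: "f v \<in> pverts H" "l' (f v) = l v" if "v \<in> pverts G" for v
    using f that by (auto simp: label_embedding_def)
  have grow: "card (sim_class G u) < sigma H" if u: "u \<in> fibre G l d" for u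
  proof -
    have uV: "u \<in> pverts G" "l u = d" using u by (auto simp: fibre_def)
    have inj: "inj_on f (sim_class G u)" and inj': "inj_on f (fibre G l d)"
      using f sim_class_subset[OF G] by (auto simp: label_embedding_def fibre_def intro: inj_on_subset)
    have "card (f ` fibre G l d) < card (fibre H l' d)" using less inj' by (simp add: card_image)
    then have "\<not> fibre H l' d \<subseteq> f ` fibre G l d"
      using card_mono[of "f ` fibre G l d" "fibre H l' d"] finite_graphD(1)[OF G] by (auto simp: fibre_def)
    then obtain w where w: "w \<in> pverts H" "l' w = d" "w \<notin> f ` fibre G l d" by (auto simp: fibre_def)
    then have w': "w \<notin> f ` pverts G" using fV by (auto simp: fibre_def)
    have "w \<in> sim_class H (f u)"
      using same_label_similar[OF compatible_sym[OF c], of "f u" w d] labels w uV fV two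
      by (simp add: sim_class_eq[OF H])
    moreover have "f ` sim_class G u \<subseteq> sim_class H (f u)"
      using embedding_similar[OF c f two labels out] by (auto simp: sim_class_eq[OF H] sim_class_eq[OF G])
    ultimately have sub: "insert w (f ` sim_class G u) \<subseteq> sim_class H (f u)" by simp
    have fin: "finite (sim_class G u)" "finite (sim_class H (f u))"
      using sim_class_subset finite_graphD(1) G H by (metis finite_subset)+
    have "w \<notin> f ` sim_class G u" using w' sim_class_subset[OF G] by blast
    then have "Suc (card (sim_class G u)) = card (insert w (f ` sim_class G u))"
      using fin inj by (simp add: card_image)
    also have "\<dots> \<le> card (sim_class H (f u))" using sub fin by (intro card_mono)
    also have "\<dots> \<le> sigma H" using fV uV by (intro sim_class_card_le_sigma[OF H]) auto
    finally show ?thesis by simp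
  qed
  obtain a where a: "a \<in> pverts G" "card (sim_class G a) = sigma G"
    using obtain_largest_class[OF G] by blast
  show ?thesis
  proof (cases "sim_class G a \<inter> fibre G l d = {}")
    case True
    obtain u where u: "u \<in> fibre G l d" using two by (auto intro: card_two_obtain_other)
    have "fibre G l d \<subseteq> sim_class G u"
      using same_label_similar[OF c, of u _ d] labels less two u
      by (auto simp: sim_class_eq[OF G] fibre_def)
    then have "card (fibre G l d) \<le> card (sim_class G u)"
      using sim_class_subset[OF G] finite_graphD(1)[OF G] by (meson card_mono finite_subset)
    moreover have "card (sim_class G a) \<le> card (fibre G l d)"
      using rest[OF True] sim_class_similar[OF G] by blast
    ultimately show ?thesis using grow[OF u] a by simp
  next
    case False
    then obtain u where u: "u \<in> sim_class G a" "u \<in> fibre G l d" by blast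
    have "sim_class G a = sim_class G u"
      using u(1) similar_trans[OF G] similar_sym[of G] unfolding sim_class_eq[OF G] by blast
    then show ?thesis using grow[OF u(2)] a by simp
  qed
qed

section \<open>Vertex types over a set of chosen vertices\<close>

text \<open>The chosen vertices \<open>g i\<close> are indexed by \<open>i \<in> I\<close>, so that types of vertices of different
  graphs can be compared.\<close>

definition vtype :: "'a pair_pre_digraph \<Rightarrow> 'i set \<Rightarrow> ('i \<Rightarrow> 'a) \<Rightarrow> 'a \<Rightarrow> 'i set \<times> 'i set" where
  "vtype G I g v = ({i \<in> I. g i = v}, {i \<in> I. (g i, v) \<in> parcs G})"

lemma vtype_eq_iff:
  "vtype G I g v = vtype H I h w \<longleftrightarrow>
     (\<forall>i\<in>I. (g i = v \<longleftrightarrow> h i = w) \<and> ((g i, v) \<in> parcs G \<longleftrightarrow> (h i, w) \<in> parcs H))"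
  by (auto simp: vtype_def set_eq_iff)

definition uniq :: "'a pair_pre_digraph \<Rightarrow> 'i set \<Rightarrow> ('i \<Rightarrow> 'a) \<Rightarrow> 'a \<Rightarrow> bool" where
  "uniq G I g v \<longleftrightarrow> v \<in> pverts G \<and> (\<forall>u\<in>pverts G. vtype G I g u = vtype G I g v \<longrightarrow> u = v)"

text \<open>Neighbours of unique type are recorded by their types, not as vertices, so that labels
  from different graphs can be equal.\<close>

definition label :: "'a pair_pre_digraph \<Rightarrow> 'i set \<Rightarrow> ('i \<Rightarrow> 'a) \<Rightarrow> 'a \<Rightarrow>
    ('i set \<times> 'i set) \<times> ('i set \<times> 'i set) set" where
  "label G I g v = (vtype G I g v, vtype G I g ` {y. uniq G I g y \<and> (y, v) \<in> parcs G})"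

lemma uniq_label:
  assumes "uniq G I g y"
  shows "vtype G I g y \<in> snd (label G I g v) \<longleftrightarrow> (y, v) \<in> parcs G"
  using assms by (auto simp: label_def uniq_def)

text \<open>Greedy choice: adding a vertex whose type is not unique and which splits the type class of
  another pair would create at least two new types.\<close>

lemma exists_saturated_set:
  assumes G: "finite_graph G"
  obtains X where "X \<subseteq> pverts G" "\<And>x y. x \<in> X \<Longrightarrow> y \<in> X \<Longrightarrow> similar G x y \<Longrightarrow> x = y"
    "2 * card X + 1 \<le> card (vtype G X (\<lambda>x. x) ` pverts G)"
    "\<And>z u v. z \<in> pverts G \<Longrightarrow> \<not> uniq G X (\<lambda>x. x) z \<Longrightarrow> u \<in> pverts G \<Longrightarrow> v \<in> pverts G \<Longrightarrow>
      u \<noteq> z \<Longrightarrow> v \<noteq> z \<Longrightarrow> vtype G X (\<lambda>x. x) u = vtype G X (\<lambda>x. x) v \<Longrightarrow>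
      (z, u) \<in> parcs G \<longleftrightarrow> (z, v) \<in> parcs G"
proof -
  let ?V = "pverts G"
  let ?T = "\<lambda>X. vtype G X (\<lambda>x. x)"
  \<comment> \<open>The clause on similarity makes every set of twins meet \<open>X\<close> in at
    most one vertex, which later bounds the classes of \<open>G\<close>.\<close>
  define good where "good X \<longleftrightarrow> X \<subseteq> ?V \<and> (\<forall>x\<in>X. \<forall>y\<in>X. similar G x y \<longrightarrow> x = y) \<and>
    2 * card X + 1 \<le> card (?T X ` ?V)" for X
  have fin: "finite ?V" "?V \<noteq> {}" using finite_graphD[OF G] by auto
  have "good {}" using fin by (simp add: good_def vtype_def Suc_le_eq card_gt_0_iff)
  moreover have "finite {X. good X}" by (rule finite_subset[of _ "Pow ?V"]) (auto simp: good_def fin)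
  ultimately obtain X where X: "good X" and max: "\<And>Y. good Y \<Longrightarrow> X \<subseteq> Y \<Longrightarrow> X = Y"
    using finite_has_maximal[of "{X. good X}"] by auto
  have "(z, u) \<in> parcs G \<longleftrightarrow> (z, v) \<in> parcs G"
    if z: "z \<in> ?V" "\<not> uniq G X (\<lambda>x. x) z" and uv: "u \<in> ?V" "v \<in> ?V" "u \<noteq> z" "v \<noteq> z"
      and same: "?T X u = ?T X v" for z u v
  proof (rule ccontr)
    assume split: "\<not> ?thesis"
    obtain z' where z': "z' \<in> ?V" "?T X z' = ?T X z" "z' \<noteq> z" using z by (auto simp: uniq_def)
    have "z \<notin> X" using z'(2,3) by (auto simp: vtype_eq_iff)
    let ?X = "insert z X"
    let ?\<pi> = "\<lambda>(S, U). (S \<inter> X, U \<inter> X)"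
    have \<pi>: "?\<pi> (?T ?X w) = ?T X w" for w by (auto simp: vtype_def)
    let ?B = "?T ?X ` (?V - {z})"
    \<comment> \<open>Since \<open>z'\<close> shares the type of \<open>z\<close>, all old types
      survive the removal of \<open>z\<close>. Separating \<open>u\<close> from \<open>v\<close>
      yields one new type, and \<open>z\<close> itself becomes another.\<close>
    have "?T X z \<in> ?T X ` (?V - {z})" using z' by (metis DiffI empty_iff image_eqI insert_iff)
    then have "?T X ` ?V = ?T X ` (?V - {z})"
      using z by (metis image_insert insert_Diff insert_absorb)
    also have "\<dots> = ?\<pi> ` ?B" by (simp add: image_image \<pi>)
    finally have im: "?T X ` ?V = ?\<pi> ` ?B" .
    have "\<not> inj_on ?\<pi> ?B"
    proof
      assume "inj_on ?\<pi> ?B"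
      moreover have "?\<pi> (?T ?X u) = ?\<pi> (?T ?X v)" using same by (simp only: \<pi>)
      ultimately have "?T ?X u = ?T ?X v" using uv by (auto dest: inj_onD)
      then show False using split by (simp add: vtype_eq_iff)
    qed
    then have "card (?\<pi> ` ?B) < card ?B"
      using fin by (metis card_image_le eq_card_imp_inj_on finite_Diff finite_imageI le_neq_implies_less)
    moreover have "?T ?X ` ?V = insert (?T ?X z) ?B" using z by auto
    moreover have "?T ?X z \<notin> ?B" by (auto simp: vtype_eq_iff)
    ultimately have "card (?T X ` ?V) + 2 \<le> card (?T ?X ` ?V)" using im fin by simp
    moreover have "card ?X = Suc (card X)"
      using \<open>z \<notin> X\<close> X fin by (auto simp: good_def dest: finite_subset)
    \<comment> \<open>A chosen twin of \<open>z\<close> would already have separated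
      \<open>u\<close> from \<open>v\<close>.\<close>
    moreover have "\<not> similar G z x" if x: "x \<in> X" for x
    proof
      assume "similar G z x"
      then have zx: "(w, z) \<in> parcs G \<longleftrightarrow> (w, x) \<in> parcs G" if "w \<in> ?V" "w \<noteq> z" "w \<noteq> x" for w
        using that by (auto simp: similar_def)
      have "(x, u) \<in> parcs G \<longleftrightarrow> (x, v) \<in> parcs G" "x = u \<longleftrightarrow> x = v"
        using same x by (auto simp: vtype_eq_iff)
      then show False
        using split zx[of u] zx[of v] uv finite_graphD(6)[OF G, of u z] finite_graphD(6)[OF G, of v z]
          finite_graphD(6)[OF G, of u x] finite_graphD(6)[OF G, of v x] by blast
    qed
    ultimately have "good ?X"
      using X z similar_sym[of G] unfolding good_def by auto
    then show False using max[of ?X] \<open>z \<notin> X\<close> by blast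
  qed
  then show ?thesis using that[of X] X unfolding good_def by blast
qed

text \<open>Each vertex outside \<open>W\<close> contributes at most one further type; hence a set
  with few types is small when many types are realized.\<close>

lemma card_image_count:
  assumes "finite V" "W \<subseteq> V"
  shows "card W + card (t ` V) \<le> card V + card (t ` W)"
proof -
  have "card (t ` V) \<le> card (t ` W) + card (t ` (V - W))"
    using assms by (metis Un_Diff_cancel card_Un_le image_Un sup.absorb2)
  also have "card (t ` (V - W)) \<le> card V - card W"
    using assms by (metis card_Diff_subset card_image_le finite_Diff finite_subset)
  finally show ?thesis using card_mono[OF assms] by simp
qed

text \<open>Distinct twins outside \<open>X\<close> share their type, so a vertex of unique type is
  neither of them and cannot tell them apart.\<close>

lemma similar_label:
  assumes G: "finite_graph G" and ab: "similar G a b" "a \<notin> X" "b \<notin> X" and X: "X \<subseteq> pverts G"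
  shows "label G X (\<lambda>x. x) a = label G X (\<lambda>x. x) b"
proof -
  have V: "a \<in> pverts G" "b \<in> pverts G" using ab by (auto simp: similar_def)
  have adj: "(w, a) \<in> parcs G \<longleftrightarrow> (w, b) \<in> parcs G" if "w \<in> pverts G" "w \<noteq> a" "w \<noteq> b" for w
    using ab that by (auto simp: similar_def)
  have t: "vtype G X (\<lambda>x. x) a = vtype G X (\<lambda>x. x) b"
    using adj ab(2,3) X by (auto simp: vtype_eq_iff)
  show ?thesis
  proof (cases "a = b")
    case False
    have "(y, a) \<in> parcs G \<longleftrightarrow> (y, b) \<in> parcs G" if "uniq G X (\<lambda>x. x) y" for y
    proof -
      have "y \<noteq> a" "y \<noteq> b" using that t False V by (auto simp: uniq_def)
      then show ?thesis using that adj[of y] by (simp add: uniq_def)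
    qed
    then show ?thesis using t by (auto simp: label_def)
  qed simp
qed

section \<open>The position after the chosen vertices have been played\<close>

locale reply =
  fixes G :: "'a pair_pre_digraph" and H :: "'b pair_pre_digraph"
    and I :: "'i set" and g :: "'i \<Rightarrow> 'a" and h :: "'i \<Rightarrow> 'b" and m :: nat
  assumes G: "finite_graph G" and H: "finite_graph H"
    and QEx: "game 0 QEx G H m ((\<lambda>i. (g i, h i)) ` I)"
    and QAll: "game 0 QAll G H m ((\<lambda>i. (g i, h i)) ` I)"
    and m: "2 \<le> m"
begin

abbreviation "P \<equiv> (\<lambda>i. (g i, h i)) ` I"

lemma flip: "reply H G I h g m"
proof
  have eq: "prod.swap ` P = (\<lambda>i. (h i, g i)) ` I" by (simp add: image_image)
  show "game 0 QEx H G m ((\<lambda>i. (h i, g i)) ` I)" "game 0 QAll H G m ((\<lambda>i. (h i, g i)) ` I)"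
    using game_swap[OF QAll] game_swap[OF QEx] by (simp_all add: eq)
qed (fact G H m)+

lemma game_iso: "game 0 q G H r Q \<Longrightarrow> partial_iso G H Q"
  by (rule game_partial_iso[OF finite_graphD(2)[OF G] finite_graphD(2)[OF H]])

lemma partial_iso_vtype:
  assumes "partial_iso G H Q" "P \<subseteq> Q" "(v, w) \<in> Q"
  shows "vtype G I g v = vtype H I h w"
proof -
  have "(g i = v \<longleftrightarrow> h i = w) \<and> ((g i, v) \<in> parcs G \<longleftrightarrow> (h i, w) \<in> parcs H)" if "i \<in> I" for i
  proof -
    have "(g i, h i) \<in> Q" using assms(2) that by blast
    then show ?thesis using partial_isoD[OF assms(1) _ assms(3)] by blast
  qed
  then show ?thesis by (simp add: vtype_eq_iff)
qed

lemma reply_one: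
  assumes "v \<in> pverts G"
  obtains w where "w \<in> pverts H" "vtype H I h w = vtype G I g v" "game 0 QEx G H (m - 1) (insert (v, w) P)"
proof -
  obtain w where w: "w \<in> pverts H" "game 0 QEx G H (m - 1) (insert (v, w) P)"
    using game_QEx[of 0 G H "m - 1" P v] QEx m assms by auto
  then have "vtype G I g v = vtype H I h w" by (intro partial_iso_vtype[OF game_iso]) auto
  then show ?thesis using that w by simp
qed

lemma reply_two:
  assumes "u \<in> pverts G" "v \<in> pverts G"
  obtains x y where "x \<in> pverts H" "y \<in> pverts H" "vtype H I h x = vtype G I g u"
    "vtype H I h y = vtype G I g v" "u = v \<longleftrightarrow> x = y" "(u, v) \<in> parcs G \<longleftrightarrow> (x, y) \<in> parcs H"
proof -
  obtain x where x: "x \<in> pverts H" "vtype H I h x = vtype G I g u" "game 0 QEx G H (m - 1) (insert (u, x) P)"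
    by (rule reply_one[OF assms(1)])
  have "m - 1 = Suc (m - 2)" using m by simp
  then obtain y where y: "y \<in> pverts H" "game 0 QEx G H (m - 2) (insert (v, y) (insert (u, x) P))"
    using x(3) game_QEx assms(2) by metis
  have iso: "partial_iso G H (insert (v, y) (insert (u, x) P))" by (rule game_iso[OF y(2)])
  have "vtype G I g v = vtype H I h y" by (rule partial_iso_vtype[OF iso]) auto
  moreover have "(u = v \<longleftrightarrow> x = y)" "(u, v) \<in> parcs G \<longleftrightarrow> (x, y) \<in> parcs H"
    using iso by (auto simp: partial_iso_def)
  ultimately show ?thesis using that x y by simp
qed

text \<open>Two vertices of \<open>G\<close> with this type, played one after the other, would need
  two answers of the same type in \<open>H\<close>.\<close>

lemma uniq_transfer:
  assumes "uniq H I h w" "v \<in> pverts G" "vtype G I g v = vtype H I h w"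
  shows "uniq G I g v"
proof -
  have "u = v" if u: "u \<in> pverts G" "vtype G I g u = vtype G I g v" for u
    using reply_two[OF u(1) assms(2)] assms u(2) unfolding uniq_def by metis
  then show ?thesis using assms(2) by (simp add: uniq_def)
qed

end

context reply
begin

interpretation fl: reply H G I h g m by (rule flip)

text \<open>In the spare round the spoiler may play any \<open>y\<close> of unique type. The answer
  has the same type and is unique too, so the vertices of this type are adjacent to \<open>v\<close>
  and to \<open>w\<close> alike.\<close>

lemma label_eq:
  assumes Q: "P \<subseteq> Q" "(v, w) \<in> Q" and game: "game 0 QEx G H (Suc r) Q"
  shows "label H I h w = label G I g v"
proof -
  have t: "vtype G I g v = vtype H I h w"
    using partial_iso_vtype[OF game_iso[OF game] Q] .
  have two: "\<exists>y'. uniq H I h y' \<and> vtype H I h y' = vtype G I g y \<and> ((y, v) \<in> parcs G \<longleftrightarrow> (y', w) \<in> parcs H)"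
    if y: "uniq G I g y" for y
  proof -
    have yV: "y \<in> pverts G" using y by (simp add: uniq_def)
    then obtain y' where y': "y' \<in> pverts H" "game 0 QEx G H r (insert (y, y') Q)"
      using game_QEx[OF game] by blast
    have iso: "partial_iso G H (insert (y, y') Q)" by (rule game_iso[OF y'(2)])
    have ty: "vtype G I g y = vtype H I h y'" by (rule partial_iso_vtype[OF iso]) (use Q in auto)
    moreover have "(y, v) \<in> parcs G \<longleftrightarrow> (y', w) \<in> parcs H"
      using partial_isoD(2)[OF iso, of y y' v w] Q(2) by simp
    ultimately show ?thesis using fl.uniq_transfer[OF y y'(1)] by auto
  qed
  have "vtype G I g ` {y. uniq G I g y \<and> (y, v) \<in> parcs G} = vtype H I h ` {y. uniq H I h y \<and> (y, w) \<in> parcs H}"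
  proof (intro equalityI subsetI)
    fix s assume "s \<in> vtype G I g ` {y. uniq G I g y \<and> (y, v) \<in> parcs G}"
    then obtain y where y: "uniq G I g y" "(y, v) \<in> parcs G" "s = vtype G I g y" by blast
    then obtain y' where "uniq H I h y'" "vtype H I h y' = s" "(y', w) \<in> parcs H"
      using two[OF y(1)] by auto
    then show "s \<in> vtype H I h ` {y. uniq H I h y \<and> (y, w) \<in> parcs H}" by blast
  next
    fix s assume "s \<in> vtype H I h ` {y. uniq H I h y \<and> (y, w) \<in> parcs H}"
    then obtain y' where y': "uniq H I h y'" "(y', w) \<in> parcs H" "s = vtype H I h y'" by blast
    have "y' \<in> pverts H" using y' by (simp add: uniq_def)
    \<comment> \<open>The game in \<open>H\<close> locates a counterpart \<open>y\<close> of
      \<open>y'\<close>; testing \<open>y\<close> in \<open>G\<close> then has to be answered by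
      \<open>y'\<close> itself, its type being unique.\<close>
    then obtain y where y: "y \<in> pverts G" "vtype G I g y = vtype H I h y'" by (rule fl.reply_one)
    then have u: "uniq G I g y" by (intro uniq_transfer[OF y'(1)])
    obtain y'' where y'': "uniq H I h y''" "vtype H I h y'' = vtype G I g y"
        "(y, v) \<in> parcs G \<longleftrightarrow> (y'', w) \<in> parcs H" using two[OF u] by blast
    have "y'' = y'" using y'' y y'(1) by (auto simp: uniq_def)
    then have "y \<in> {y. uniq G I g y \<and> (y, v) \<in> parcs G}" using y'' y' u by auto
    moreover have "s = vtype G I g y" using y y' by simp
    ultimately show "s \<in> vtype G I g ` {y. uniq G I g y \<and> (y, v) \<in> parcs G}" by (rule rev_image_eqI)
  qed
  then show ?thesis using t by (simp add: label_def)
qed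

lemma label_subset: "label G I g ` pverts G \<subseteq> label H I h ` pverts H"
proof
  fix d assume "d \<in> label G I g ` pverts G"
  then obtain v where v: "v \<in> pverts G" "d = label G I g v" by blast
  obtain w where w: "w \<in> pverts H" "game 0 QEx G H (m - 1) (insert (v, w) P)"
    by (rule reply_one[OF v(1)])
  have "m - 1 = Suc (m - 2)" using m by simp
  then have "label H I h w = label G I g v"
    using w(2) by (intro label_eq[where Q = "insert (v, w) P" and r = "m - 2"]) auto
  then show "d \<in> label H I h ` pverts H" using w v by (metis imageI)
qed

text \<open>Overfilling the fibre of \<open>H\<close> takes one round more than its size, and
  \<open>label_eq\<close> one round further, whence the 2.\<close>

lemma fibre_less:
  assumes less: "card (fibre H (label H I h) d) < card (fibre G (label G I g) d)"
  shows "m < card (fibre H (label H I h) d) + 2"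
proof (rule ccontr)
  let ?n = "Suc (card (fibre H (label H I h) d))"
  assume "\<not> ?thesis"
  then have m': "m - ?n = Suc (m - Suc ?n)" "?n \<le> m" by auto
  obtain A where A: "A \<subseteq> fibre G (label G I g) d" "card A = ?n" "finite A"
    using less obtain_subset_with_card_n[of ?n "fibre G (label G I g) d"] by auto
  then have AV: "A \<subseteq> pverts G" by (auto simp: fibre_def)
  obtain f where f: "f ` A \<subseteq> pverts H" "game 0 QEx G H (m - ?n) (P \<union> (\<lambda>a. (a, f a)) ` A)"
    using game_QEx_moves[OF A(3) AV _ QEx] m' A(2) by auto
  have iso: "partial_iso G H (P \<union> (\<lambda>a. (a, f a)) ` A)" by (rule game_iso[OF f(2)])
  have inj: "inj_on f A"
  proof (rule inj_onI)
    fix a b assume ab: "a \<in> A" "b \<in> A" "f a = f b"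
    have "(a, f a) \<in> P \<union> (\<lambda>a. (a, f a)) ` A" "(b, f b) \<in> P \<union> (\<lambda>a. (a, f a)) ` A"
      using ab by auto
    then show "a = b" using partial_isoD(1)[OF iso] ab(3) by blast
  qed
  have "label H I h (f a) = d" if a: "a \<in> A" for a
  proof -
    have "label H I h (f a) = label G I g a"
      using f(2) a unfolding m'(1) by (intro label_eq[where r = "m - Suc ?n"]) auto
    then show ?thesis using A a by (auto simp: fibre_def)
  qed
  then have "f ` A \<subseteq> fibre H (label H I h) d" using f by (auto simp: fibre_def)
  then have "card (f ` A) \<le> card (fibre H (label H I h) d)"
    using finite_graphD(1)[OF H] by (intro card_mono) (auto simp: fibre_def)
  then show False using A inj by (simp add: card_image)
qed

text \<open>Outside the unique vertices, adjacency in \<open>G\<close> depends on types only; the spoiler could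
  exploit any deviation of \<open>H\<close> from this in two moves.\<close>

lemma compatible_labels:
  assumes sat: "\<And>z u v. z \<in> pverts G \<Longrightarrow> \<not> uniq G I g z \<Longrightarrow> u \<in> pverts G \<Longrightarrow> v \<in> pverts G \<Longrightarrow>
      u \<noteq> z \<Longrightarrow> v \<noteq> z \<Longrightarrow> vtype G I g u = vtype G I g v \<Longrightarrow> (z, u) \<in> parcs G \<longleftrightarrow> (z, v) \<in> parcs G"
  shows "compatible G (label G I g) H (label H I h)"
proof -
  \<comment> \<open>One end is exchanged at a time, seen from an end of non-unique type. If the new
    end is \<open>z1\<close> itself, all four vertices have the same type and one exchange is
    enough.\<close>
  have homog: "(z1, z2) \<in> parcs G \<longleftrightarrow> (z3, z4) \<in> parcs G"
    if z: "z1 \<in> pverts G" "z2 \<in> pverts G" "z3 \<in> pverts G" "z4 \<in> pverts G" "z1 \<noteq> z2" "z3 \<noteq> z4"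
      and u: "\<not> uniq G I g z1" "\<not> uniq G I g z4"
      and t: "vtype G I g z1 = vtype G I g z3" "vtype G I g z2 = vtype G I g z4" for z1 z2 z3 z4
  proof (cases "z4 = z1")
    case True
    then have "(z1, z2) \<in> parcs G \<longleftrightarrow> (z1, z3) \<in> parcs G" using z t u by (intro sat) auto
    then show ?thesis using True finite_graphD(6)[OF G, of z1 z3] by simp
  next
    case False
    have "(z1, z2) \<in> parcs G \<longleftrightarrow> (z1, z4) \<in> parcs G" using z t u False by (intro sat) auto
    moreover have "(z4, z1) \<in> parcs G \<longleftrightarrow> (z4, z3) \<in> parcs G" using z t u False by (intro sat) auto
    ultimately show ?thesis
      using finite_graphD(6)[OF G, of z1 z4] finite_graphD(6)[OF G, of z3 z4] by simp
  qed
  have "(u, v) \<in> parcs G \<longleftrightarrow> (x, y) \<in> parcs H"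
    if V: "u \<in> pverts G" "v \<in> pverts G" "x \<in> pverts H" "y \<in> pverts H" "u \<noteq> v" "x \<noteq> y"
      and l: "label G I g u = label H I h x" "label G I g v = label H I h y" for u v x y
  proof -
    have t: "vtype G I g u = vtype H I h x" "vtype G I g v = vtype H I h y"
      using l by (auto simp: label_def)
    consider "uniq G I g u" | "uniq G I g v" | "\<not> uniq G I g u" "\<not> uniq G I g v" by blast
    then show ?thesis
    proof cases
      case 1
      then have "uniq H I h x" using fl.uniq_transfer V t by auto
      then show ?thesis
        using uniq_label[OF 1, of v] uniq_label[of H I h x y] l t by simp
    next
      case 2
      then have "uniq H I h y" using fl.uniq_transfer V t by auto
      then have "(v, u) \<in> parcs G \<longleftrightarrow> (y, x) \<in> parcs H"
        using uniq_label[OF 2, of u] uniq_label[of H I h y x] l t by simp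
      then show ?thesis using finite_graphD(6)[OF G, of u v] finite_graphD(6)[OF H, of x y] by simp
    next
      case 3
      obtain a b where ab: "a \<in> pverts G" "b \<in> pverts G" "vtype G I g a = vtype H I h x"
          "vtype G I g b = vtype H I h y" "x = y \<longleftrightarrow> a = b" "(x, y) \<in> parcs H \<longleftrightarrow> (a, b) \<in> parcs G"
        by (rule fl.reply_two[OF V(3,4)])
      have "\<not> uniq G I g b" using 3(2) ab t V by (auto simp: uniq_def)
      then have "(u, v) \<in> parcs G \<longleftrightarrow> (a, b) \<in> parcs G"
        using V ab t 3 by (intro homog) auto
      then show ?thesis using ab by simp
    qed
  qed
  then show ?thesis using G H by (simp add: compatible_def)
qed

end

section \<open>One alternation and (n + 5)/2 rounds determine a graph up to the size of its largest
  class\<close>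

lemma isomorphic_or_sigma_differs:
  assumes G: "finite_graph G" and H: "finite_graph H"
    and game: "game 1 QEx G H ((order G + 5) div 2) {}" and sigma: "sigma G = sigma H"
  shows "isomorphic G H"
proof -
  let ?R = "(order G + 5) div 2"
  have finG: "finite (pverts G)" and finH: "finite (pverts H)" using G H finite_graphD(1) by auto
  obtain X where X: "X \<subseteq> pverts G" "\<And>x y. x \<in> X \<Longrightarrow> y \<in> X \<Longrightarrow> similar G x y \<Longrightarrow> x = y"
    "2 * card X + 1 \<le> card (vtype G X (\<lambda>x. x) ` pverts G)"
    "\<And>z u v. z \<in> pverts G \<Longrightarrow> \<not> uniq G X (\<lambda>x. x) z \<Longrightarrow> u \<in> pverts G \<Longrightarrow> v \<in> pverts G \<Longrightarrow>
      u \<noteq> z \<Longrightarrow> v \<noteq> z \<Longrightarrow> vtype G X (\<lambda>x. x) u = vtype G X (\<lambda>x. x) v \<Longrightarrow>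
      (z, u) \<in> parcs G \<longleftrightarrow> (z, v) \<in> parcs G"
    by (rule exists_saturated_set[OF G]) blast
  \<comment> \<open>Used with sets of one or two types, whose size it bounds by n - 2|X| and n + 1 -
    2|X|.\<close>
  have count: "card W + 2 * card X + 1 \<le> order G + card (vtype G X (\<lambda>x. x) ` W)"
    if "W \<subseteq> pverts G" for W
    using card_image_count[OF finG that, of "vtype G X (\<lambda>x. x)"] X(3) by (simp add: order_def)
  have "2 * card X + 1 \<le> order G" using count[of "{}"] by simp
  then have R: "2 \<le> ?R - card X" "card X \<le> ?R" by auto
  have finX: "finite X" using X(1) finG by (rule finite_subset)
  obtain h where h: "h ` X \<subseteq> pverts H" "game 1 QEx G H (?R - card X) ((\<lambda>a. (a, h a)) ` X)"
    using game_QEx_moves[OF finX X(1) R(2) game] by auto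
  interpret r: reply G H X "\<lambda>x. x" h "?R - card X"
  proof
    show "game 0 QEx G H (?R - card X) ((\<lambda>i. (i, h i)) ` X)"
      using h(2) game_less_alternations[of 0] by simp
    show "game 0 QAll G H (?R - card X) ((\<lambda>i. (i, h i)) ` X)"
      using h(2) game_switch[of 0 QEx] by simp
  qed (fact G H R)+
  interpret fl: reply H G X h "\<lambda>x. x" "?R - card X" by (rule r.flip)
  let ?l = "label G X (\<lambda>x. x)" and ?l' = "label H X h"
  let ?c = "\<lambda>d. card (fibre G ?l d)" and ?c' = "\<lambda>d. card (fibre H ?l' d)"
  have c: "compatible G ?l H ?l'" using r.compatible_labels[OF X(4)] by blast
  have labels: "?l ` pverts G = ?l' ` pverts H" using r.label_subset fl.label_subset by blast
  have differ: "2 \<le> min (?c d) (?c' d) \<and> (\<forall>d'. d' \<noteq> d \<longrightarrow> ?c d' < min (?c d) (?c' d))"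
    if d: "?c d \<noteq> ?c' d" for d
  proof -
    have "?R - card X < min (?c d) (?c' d) + 2"
      using r.fibre_less[of d] fl.fibre_less[of d] d by (cases "?c d < ?c' d") auto
    \<comment> \<open>\<open>fibre_less\<close>, applied in the right direction, gives R <= |X| +
      min + 1 for the number R of rounds, and n + 4 <= 2R.\<close>
    then have m: "order G + 2 \<le> 2 * card X + 2 * min (?c d) (?c' d)" using R by linarith
    have ty: "vtype G X (\<lambda>x. x) ` fibre G ?l e \<subseteq> {fst e}" for e by (auto simp: fibre_def label_def)
    have "card (vtype G X (\<lambda>x. x) ` fibre G ?l d) \<le> 1" using card_mono[OF _ ty] by fastforce
    then have "?c d + 2 * card X \<le> order G" using count[of "fibre G ?l d"] by (auto simp: fibre_def)
    then have "2 \<le> min (?c d) (?c' d)" using m by linarith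
    moreover have "?c d' < min (?c d) (?c' d)" if "d' \<noteq> d" for d'
    proof -
      have "vtype G X (\<lambda>x. x) ` (fibre G ?l d \<union> fibre G ?l d') \<subseteq> {fst d, fst d'}"
        using ty[of d] ty[of d'] by (auto simp: image_Un)
      then have "card (vtype G X (\<lambda>x. x) ` (fibre G ?l d \<union> fibre G ?l d')) \<le> card {fst d, fst d'}"
        by (intro card_mono) auto
      also have "\<dots> \<le> 2" by (simp add: card_insert_le_m1)
      \<comment> \<open>The union of the two fibres is thus smaller than twice the minimum, while
        the fibre of \<open>d\<close> reaches the minimum; the other fibre must stay below
        it.\<close>
      finally have "card (fibre G ?l d \<union> fibre G ?l d') + 2 * card X \<le> order G + 1"
        using count[of "fibre G ?l d \<union> fibre G ?l d'"] by (auto simp: fibre_def)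
      moreover have "card (fibre G ?l d \<union> fibre G ?l d') = ?c d + ?c d'"
        using that finG by (intro card_Un_disjoint) (auto simp: fibre_def)
      ultimately show ?thesis using m by linarith
    qed
    ultimately show ?thesis by blast
  qed
  \<comment> \<open>A set of twins has at most one chosen vertex, and its other vertices share a
    label different from \<open>d\<close>; their fibre is strictly below the minimum, which
    compensates for the chosen vertex.\<close>
  have bound: "card A \<le> min (?c d) (?c' d)"
    if d: "?c d \<noteq> ?c' d" and A: "A \<inter> fibre G ?l d = {}" "\<And>x y. x \<in> A \<Longrightarrow> y \<in> A \<Longrightarrow> similar G x y" for A d
  proof -
    have AV: "A \<subseteq> pverts G" using A by (auto simp: similar_def)
    then have finA: "finite A" using finG by (rule finite_subset)
    have "\<forall>x\<in>A \<inter> X. \<forall>y\<in>A \<inter> X. x = y" using A(2) X(2) by blast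
    then have "card (A \<inter> X) \<le> 1" using finA by (simp add: card_le_Suc0_iff_eq)
    moreover have "card (A - X) < min (?c d) (?c' d)"
    proof (cases "A - X = {}")
      case False
      then obtain a where a: "a \<in> A" "a \<notin> X" by blast
      have "A - X \<subseteq> fibre G ?l (?l a)"
      proof
        fix b assume b: "b \<in> A - X"
        then have "?l b = ?l a" using similar_label[OF G A(2) _ _ X(1), of b a] a by blast
        then show "b \<in> fibre G ?l (?l a)" using b AV by (auto simp: fibre_def)
      qed
      then have "card (A - X) \<le> ?c (?l a)" using finG by (intro card_mono) (auto simp: fibre_def)
      moreover have "?l a \<noteq> d" using A(1) a AV by (auto simp: fibre_def)
      then have "?c (?l a) < min (?c d) (?c' d)" using differ[OF d] by blast
      ultimately show ?thesis by simp
    next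
      case True
      then have "card (A - X) = 0" by (simp only: card.empty)
      then show ?thesis using differ[OF d] by linarith
    qed
    moreover have "card A = card (A \<inter> X) + card (A - X)"
      using finA by (metis card_Int_Diff)
    ultimately show ?thesis by simp
  qed
  show ?thesis
  proof (cases "\<forall>d. ?c d = ?c' d")
    case True
    then show ?thesis using compatible_isomorphic[OF c] by blast
  next
    case False
    then obtain d where d: "?c d \<noteq> ?c' d" by blast
    have other: "?c d' = ?c' d'" if "d' \<noteq> d" for d'
    proof (rule ccontr)
      assume ne: "?c d' \<noteq> ?c' d'"
      have "?c d' < min (?c d) (?c' d)" using differ[OF d] that by blast
      moreover have "?c d < min (?c d') (?c' d')" using differ[OF ne] that[symmetric] by blast
      ultimately show False by linarith
    qed
    have two: "2 \<le> ?c d" "2 \<le> ?c' d" using differ[OF d] by auto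
    show ?thesis
    proof (cases "?c d < ?c' d")
      case True
      then have "?c e \<le> ?c' e" for e using other[of e] by (cases "e = d") auto
      then obtain f where f: "label_embedding f G ?l H ?l'" using label_embedding_exists[OF G H] by blast
      have "sigma G < sigma H"
      proof (rule sigma_less[OF c f two(1) True labels])
        show "?l' w = d" if "w \<in> pverts H" "w \<notin> f ` pverts G" for w
          using label_embedding_onto[OF c f] other that by blast
        show "card A \<le> ?c d" if "A \<inter> fibre G ?l d = {}" "\<And>x y. x \<in> A \<Longrightarrow> y \<in> A \<Longrightarrow> similar G x y" for A
          using bound[OF d that] by simp
      qed
      then show ?thesis using sigma by simp
    next
      case False
      then have less: "?c' d < ?c d" using d by simp
      then have "?c' e \<le> ?c e" for e using other[of e] by (cases "e = d") auto
      then obtain f where f: "label_embedding f H ?l' G ?l" using label_embedding_exists[OF H G] by blast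
      have out: "?l w = d" if "w \<in> pverts G" "w \<notin> f ` pverts H" for w
        using label_embedding_onto[OF compatible_sym[OF c] f] other that by metis
      have "sigma H < sigma G"
      proof (rule sigma_less[OF compatible_sym[OF c] f two(2) less labels[symmetric] out])
        \<comment> \<open>\<open>bound\<close> speaks of twins of \<open>G\<close>, so the twins of
          \<open>H\<close> are carried to \<open>G\<close> by the embedding.\<close>
        show "card A \<le> ?c' d" if A: "A \<inter> fibre H ?l' d = {}" "\<And>x y. x \<in> A \<Longrightarrow> y \<in> A \<Longrightarrow> similar H x y" for A
        proof -
          have AV: "A \<subseteq> pverts H" using A by (auto simp: similar_def)
          have "similar G x y" if "x \<in> f ` A" "y \<in> f ` A" for x y
            using embedding_similar[OF compatible_sym[OF c] f two(2) labels[symmetric] out] A(2) that by blast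
          moreover have "f ` A \<inter> fibre G ?l d = {}"
          proof -
            have "?l (f a) \<noteq> d" if "a \<in> A" for a
            proof -
              have "a \<notin> fibre H ?l' d" using A(1) that by blast
              then show ?thesis using AV f that by (auto simp: fibre_def label_embedding_def)
            qed
            then show ?thesis by (auto simp: fibre_def)
          qed
          ultimately have "card (f ` A) \<le> ?c' d" using bound[OF d, of "f ` A"] by simp
          moreover have "inj_on f A" using AV f by (auto simp: label_embedding_def intro: inj_on_subset)
          ultimately show ?thesis by (simp add: card_image)
        qed
      qed
      then show ?thesis using sigma by simp
    qed
  qed
qed

section \<open>Upper bounds\<close>

text \<open>\<open>fo_defines\<close> compares with all binary structures; two rounds played in
  \<open>H\<close> expose a loop or a one-way arc.\<close>

lemma game_finite_graph:
  assumes G: "finite_graph G" and H: "finite_structure H"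
    and game: "game k QAll G H r {}" and r: "2 \<le> r"
  shows "finite_graph H"
proof -
  interpret H: pair_fin_digraph H using H by (simp add: finite_structure_def)
  have ne: "pverts G \<noteq> {}" "pverts H \<noteq> {}"
    using G H by (auto simp: finite_structure_def finite_graph_def)
  obtain r' where r': "r = Suc (Suc r')" using r by (metis add_2_eq_Suc le_Suc_ex)
  have game': "game k QEx H G (Suc (Suc r')) {}" using game_swap_initial[OF game] unfolding r' .
  have "x \<noteq> y \<and> (y, x) \<in> parcs H" if xy: "(x, y) \<in> parcs H" for x y
  proof -
    obtain a where a: "game k QEx H G (Suc r') {(x, a)}"
      using game_QEx[OF game'] H.in_arcsD1[OF xy] by blast
    obtain b where b: "game k QEx H G r' {(y, b), (x, a)}"
      using game_QEx[OF a] H.in_arcsD2[OF xy] by blast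
    have iso: "partial_iso H G {(y, b), (x, a)}" by (rule game_partial_iso[OF ne(2,1) b])
    have "(a, b) \<in> parcs G" "(y, x) \<in> parcs H \<longleftrightarrow> (b, a) \<in> parcs G" "x = y \<longleftrightarrow> a = b"
      using iso xy by (auto simp: partial_iso_def)
    then show ?thesis using finite_graphD(5)[OF G] finite_graphD(6)[OF G, of a b] by auto
  qed
  then show ?thesis
    using ne H.pair_finite_verts H.in_arcsD1 H.in_arcsD2 by (auto simp: finite_graph_iff)
qed

text \<open>By pigeonhole two of the \<open>sigma H + 1\<close> answers are not twins. The vertex
  separating them lies in \<open>H\<close>, so the last round spends the one alternation.\<close>

lemma larger_class_wins:
  assumes G: "finite_graph G" and H: "finite_graph H" and less: "sigma H < sigma G"
    and r: "sigma H + 2 \<le> r"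
  shows "\<not> game 1 QEx G H r {}"
proof
  assume game: "game 1 QEx G H r {}"
  let ?n = "sigma H + 1"
  have ne: "pverts G \<noteq> {}" "pverts H \<noteq> {}" using finite_graphD(2) G H by auto
  obtain u where u: "card (sim_class G u) = sigma G" using obtain_largest_class[OF G] by blast
  then obtain A where A: "A \<subseteq> sim_class G u" "card A = ?n" "finite A"
    using less obtain_subset_with_card_n[of ?n "sim_class G u"] by auto
  then have AV: "A \<subseteq> pverts G" using sim_class_subset[OF G] by blast
  let ?Q = "\<lambda>f. (\<lambda>a. (a, f a)) ` A"
  obtain f where f: "f ` A \<subseteq> pverts H" "game 1 QEx G H (r - ?n) (?Q f)"
    using game_QEx_moves[OF A(3) AV _ game] r A(2) by auto
  have inj: "inj_on f A"
    by (rule inj_onI) (use partial_isoD(1)[OF game_partial_iso[OF ne f(2)]] in blast)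
  have "\<exists>a\<in>A. \<exists>b\<in>A. \<not> similar H (f a) (f b)"
  proof (rule ccontr)
    assume "\<not> ?thesis"
    then have "card (f ` A) \<le> sigma H" by (intro similar_card_le_sigma[OF H]) auto
    then show False using inj A by (simp add: card_image)
  qed
  then obtain a b where ab: "a \<in> A" "b \<in> A" "\<not> similar H (f a) (f b)" by blast
  then obtain w where w: "w \<in> pverts H" "w \<noteq> f a" "w \<noteq> f b"
      "(w, f a) \<in> parcs H \<longleftrightarrow> (w, f b) \<notin> parcs H"
    using f(1) by (auto simp: similar_def)
  have "r - ?n = Suc (r - Suc ?n)" using r by simp
  then have "game 0 QAll G H (Suc (r - Suc ?n)) (?Q f)" using f(2) game_switch[of 0 QEx] by simp
  then obtain v where v: "v \<in> pverts G" "game 0 QAll G H (r - Suc ?n) (insert (v, w) (?Q f))"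
    using w(1) by (auto simp: move_def)
  have iso: "partial_iso G H (insert (v, w) (?Q f))" by (rule game_partial_iso[OF ne v(2)])
  have "v \<noteq> a" "v \<noteq> b" "(v, a) \<in> parcs G \<longleftrightarrow> (w, f a) \<in> parcs H" "(v, b) \<in> parcs G \<longleftrightarrow> (w, f b) \<in> parcs H"
    using partial_isoD[OF iso, of v w a "f a"] partial_isoD[OF iso, of v w b "f b"] ab w by auto
  moreover have "similar G a b" using ab A sim_class_similar[OF G] by blast
  ultimately show False using w v by (auto simp: similar_def)
qed

text \<open>A single truth value \<open>c\<close> lets cliques and independent sets be treated at
  once.\<close>

lemma homogeneousE:
  assumes "homogeneous G X"
  obtains c where "\<And>u v. u \<in> X \<Longrightarrow> v \<in> X \<Longrightarrow> u \<noteq> v \<Longrightarrow> (u, v) \<in> parcs G \<longleftrightarrow> c"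
proof -
  from assms have "(\<forall>u\<in>X. \<forall>v\<in>X. u \<noteq> v \<longrightarrow> (u, v) \<in> parcs G) \<or> (\<forall>u\<in>X. \<forall>v\<in>X. u \<noteq> v \<longrightarrow> (u, v) \<notin> parcs G)"
    by (simp add: homogeneous_def)
  then show ?thesis
  proof
    assume "\<forall>u\<in>X. \<forall>v\<in>X. u \<noteq> v \<longrightarrow> (u, v) \<in> parcs G"
    then show ?thesis by (intro that[of True]) simp
  next
    assume "\<forall>u\<in>X. \<forall>v\<in>X. u \<noteq> v \<longrightarrow> (u, v) \<notin> parcs G"
    then show ?thesis by (intro that[of False]) simp
  qed
qed

lemma homogeneousI:
  assumes "X \<subseteq> pverts G" "\<And>u v. u \<in> X \<Longrightarrow> v \<in> X \<Longrightarrow> u \<noteq> v \<Longrightarrow> (u, v) \<in> parcs G \<longleftrightarrow> c"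
  shows "homogeneous G X"
  using assms by (cases c) (auto simp: homogeneous_def)

text \<open>A larger homogeneous set \<open>B\<close> would share two vertices with
  \<open>C\<close>, hence be of the same kind. A vertex of \<open>B\<close> outside \<open>C\<close>
  relates in this way to one vertex of \<open>C\<close>, therefore to all of its twins, and so would
  extend \<open>C\<close>.\<close>

lemma homogeneous_card_le:
  assumes G: "finite_graph G" and C: "largest_class G C" "maximal_homogeneous G C"
    and large: "order G + 1 < 2 * sigma G" and B: "homogeneous G B"
  shows "card B \<le> sigma G"
proof (rule ccontr)
  assume "\<not> ?thesis"
  then have big: "sigma G < card B" by simp
  obtain u where u: "C = sim_class G u" "card C = sigma G" using C by (auto simp: largest_class_def)
  have CV: "C \<subseteq> pverts G" using sim_class_subset[OF G] u by simp
  have BV: "B \<subseteq> pverts G" using B by (simp add: homogeneous_def)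
  have fin: "finite B" "finite C" using CV BV finite_graphD(1)[OF G] finite_subset by auto
  have "card (B \<union> C) + card (B \<inter> C) = card B + card C" using card_Un_Int[OF fin] by simp
  moreover have "card (B \<union> C) \<le> order G"
    unfolding order_def using CV BV finite_graphD(1)[OF G] by (intro card_mono) auto
  ultimately have two: "2 \<le> card (B \<inter> C)" using big large u(2) by linarith
  have "\<not> B \<subseteq> C" using big card_mono[OF fin(2), of B] u(2) by auto
  then obtain w where w: "w \<in> B" "w \<notin> C" by blast
  obtain c where c: "\<And>x y. x \<in> B \<Longrightarrow> y \<in> B \<Longrightarrow> x \<noteq> y \<Longrightarrow> (x, y) \<in> parcs G \<longleftrightarrow> c"
    using homogeneousE[OF B] by blast
  obtain a where a: "a \<in> B \<inter> C" by (rule card_two_obtain_other[OF two])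
  obtain b where b: "b \<in> B \<inter> C" "b \<noteq> a" by (rule card_two_obtain_other[OF two])
  obtain c' where c': "\<And>x y. x \<in> C \<Longrightarrow> y \<in> C \<Longrightarrow> x \<noteq> y \<Longrightarrow> (x, y) \<in> parcs G \<longleftrightarrow> c'"
    using homogeneousE[of G C] C(2) unfolding maximal_homogeneous_def by blast
  have cc': "c' = c" using c[of a b] c'[of a b] a b by auto
  have wC: "(w, x) \<in> parcs G \<longleftrightarrow> c" if x: "x \<in> C" for x
  proof -
    have "similar G a x" using a x u sim_class_similar[OF G] by blast
    then have "(w, a) \<in> parcs G \<longleftrightarrow> (w, x) \<in> parcs G" using w a x BV by (auto simp: similar_def)
    moreover have "(w, a) \<in> parcs G \<longleftrightarrow> c" using c[of w a] w a by auto
    ultimately show ?thesis by simp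
  qed
  have "(x, y) \<in> parcs G \<longleftrightarrow> c" if xy: "x \<in> insert w C" "y \<in> insert w C" "x \<noteq> y" for x y
  proof -
    consider "x = w" "y \<in> C" | "y = w" "x \<in> C" | "x \<in> C" "y \<in> C" using xy by blast
    then show ?thesis
    proof cases
      case 1
      then show ?thesis using wC[of y] by simp
    next
      case 2
      then show ?thesis using wC[of x] finite_graphD(6)[OF G, of x w] by simp
    next
      case 3
      then show ?thesis using c'[of x y] xy cc' by simp
    qed
  qed
  then have "homogeneous G (insert w C)" using CV BV w by (intro homogeneousI[of _ _ c]) auto
  then show False using C(2) w unfolding maximal_homogeneous_def by blast
qed

text \<open>Unlike similarity, homogeneity is visible within the answers themselves: twins of
  \<open>H\<close> would be answered by a homogeneous set of \<open>sigma G + 1\<close> vertices,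
  without a separating round or an alternation.\<close>

lemma larger_homogeneous_wins:
  assumes G: "finite_graph G" and H: "finite_graph H" and less: "sigma G < sigma H"
    and C: "largest_class G C" "maximal_homogeneous G C"
    and large: "order G + 1 < 2 * sigma G" and r: "sigma G + 1 \<le> r"
  shows "\<not> game k QAll G H r {}"
proof
  assume "game k QAll G H r {}"
  then have game: "game k QEx H G r {}" by (rule game_swap_initial)
  let ?n = "sigma G + 1"
  have ne: "pverts G \<noteq> {}" "pverts H \<noteq> {}" using finite_graphD(2) G H by auto
  obtain u where u: "card (sim_class H u) = sigma H" using obtain_largest_class[OF H] by blast
  then obtain A where A: "A \<subseteq> sim_class H u" "card A = ?n" "finite A"
    using less obtain_subset_with_card_n[of ?n "sim_class H u"] by auto
  then have AV: "A \<subseteq> pverts H" using sim_class_subset[OF H] by blast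
  obtain f where f: "f ` A \<subseteq> pverts G" "game k QEx H G (r - ?n) ((\<lambda>a. (a, f a)) ` A)"
    using game_QEx_moves[OF A(3) AV _ game] r A(2) by auto
  note iso = partial_isoD[OF game_partial_iso[OF ne(2,1) f(2)]]
  have inj: "inj_on f A" by (rule inj_onI) (use iso(1) in blast)
  have "homogeneous H A"
    by (rule similar_homogeneous[OF H]) (use A sim_class_similar[OF H] in blast)
  then obtain c where c: "\<And>x y. x \<in> A \<Longrightarrow> y \<in> A \<Longrightarrow> x \<noteq> y \<Longrightarrow> (x, y) \<in> parcs H \<longleftrightarrow> c"
    using homogeneousE by blast
  have "(f x, f y) \<in> parcs G \<longleftrightarrow> c" if "x \<in> A" "y \<in> A" "f x \<noteq> f y" for x y
  proof -
    have "(x, y) \<in> parcs H \<longleftrightarrow> (f x, f y) \<in> parcs G" using that by (intro iso(2)) auto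
    moreover have "(x, y) \<in> parcs H \<longleftrightarrow> c" using that by (intro c) auto
    ultimately show ?thesis by simp
  qed
  then have "homogeneous G (f ` A)" using f(1) by (intro homogeneousI[of _ _ c]) auto
  then have "card (f ` A) \<le> sigma G" by (rule homogeneous_card_le[OF G C large])
  then show False using inj A by (simp add: card_image)
qed

text \<open>\<open>r\<close> stays free since three values occur: the general bound,
  \<open>sigma G + 1\<close> and \<open>sigma G + 2\<close>. The alternatives in
  \<open>extra\<close> are the two ways to beat a graph with a larger class.\<close>

lemma depth_alt_1_le:
  assumes G: "finite_graph G" and R: "(order G + 5) div 2 \<le> r" and s: "sigma G + 1 \<le> r"
    and extra: "sigma G + 2 \<le> r \<or>
      order G + 1 < 2 * sigma G \<and> (\<exists>C. largest_class G C \<and> maximal_homogeneous G C)"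
  shows "depth_alt 1 G \<le> enat r"
proof (rule depth_alt_le[OF G])
  show "r > 0" using s by simp
  fix H :: "nat pair_pre_digraph"
  assume H: "finite_structure H" and ex: "game 1 QEx G H r {}" and al: "game 1 QAll G H r {}"
  have HG: "finite_graph H"
    by (rule game_finite_graph[OF G H al]) (use R in linarith)
  have "game 1 QEx G H ((order G + 5) div 2) {}"
    using game_anti_rounds[OF finite_graphD(2)[OF G] finite_graphD(2)[OF HG] R ex] .
  moreover have "\<not> sigma H < sigma G" using larger_class_wins[OF G HG _ _ , of r] ex s by linarith
  moreover have "\<not> sigma G < sigma H"
    using extra
  proof
    assume "sigma G + 2 \<le> r"
    then show ?thesis using larger_class_wins[OF HG G _ ] game_swap_initial[OF al] by blast
  next
    assume "order G + 1 < 2 * sigma G \<and> (\<exists>C. largest_class G C \<and> maximal_homogeneous G C)"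
    then show ?thesis using larger_homogeneous_wins[OF G HG] al s by blast
  qed
  ultimately show "isomorphic G H" using isomorphic_or_sigma_differs[OF G HG] by simp
qed

section \<open>Expressing a large twin class with few variables\<close>

lemma sat_foldr_Exi:
  "distinct xs \<Longrightarrow> sat G e (foldr Exi xs \<phi>) \<longleftrightarrow>
     (\<exists>a. (\<forall>x\<in>set xs. a x \<in> pverts G) \<and> sat G (\<lambda>x. if x \<in> set xs then a x else e x) \<phi>)"
proof (induction xs arbitrary: e)
  case (Cons x xs)
  have "sat G e (foldr Exi (x # xs) \<phi>) \<longleftrightarrow> (\<exists>b\<in>pverts G. \<exists>a. (\<forall>y\<in>set xs. a y \<in> pverts G) \<and>
      sat G (\<lambda>y. if y \<in> set xs then a y else (e(x := b)) y) \<phi>)" (is "_ \<longleftrightarrow> ?L")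
    using Cons by simp
  also have "\<dots> \<longleftrightarrow> (\<exists>a. (\<forall>y\<in>set (x # xs). a y \<in> pverts G) \<and>
      sat G (\<lambda>y. if y \<in> set (x # xs) then a y else e y) \<phi>)" (is "_ \<longleftrightarrow> ?R")
  proof
    assume ?L
    then obtain a b where ab: "b \<in> pverts G" "\<forall>y\<in>set xs. a y \<in> pverts G"
      "sat G (\<lambda>y. if y \<in> set xs then a y else (e(x := b)) y) \<phi>" by blast
    have "(\<lambda>y. if y \<in> set xs then a y else (e(x := b)) y) =
        (\<lambda>y. if y \<in> set (x # xs) then (a(x := b)) y else e y)"
      using Cons.prems by auto
    then show ?R using ab by (intro exI[of _ "a(x := b)"]) auto
  next
    assume ?R
    then obtain a where a: "\<forall>y\<in>set (x # xs). a y \<in> pverts G"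
      "sat G (\<lambda>y. if y \<in> set (x # xs) then a y else e y) \<phi>" by blast
    have "(\<lambda>y. if y \<in> set (x # xs) then a y else e y) =
        (\<lambda>y. if y \<in> set xs then a y else (e(x := a x)) y)"
      by auto
    then show ?L using a by (intro bexI[of _ "a x"] exI[of _ a]) auto
  qed
  finally show ?case .
qed simp

lemma vars_foldr_Exi [simp]: "vars (foldr Exi xs \<phi>) = set xs \<union> vars \<phi>"
  by (induction xs) auto

lemma free_vars_foldr_Exi [simp]: "free_vars (foldr Exi xs \<phi>) = free_vars \<phi> - set xs"
  by (induction xs) auto

text \<open>With at least three variables at hand, a third one can be reused to say that two vertices
  are twins.\<close>

definition twins_formula :: "nat list \<Rightarrow> fm" where
  "twins_formula xs = conjs (concat (map (\<lambda>i. concat (map (\<lambda>j. concat (map (\<lambda>k.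
     if i = j \<or> i = k \<or> j = k then [] else
       [Neg (Eq i j), Neg (Exi k (Conj (Conj (Neg (Eq k i)) (Neg (Eq k j))) (Conj (Adj k i) (Neg (Adj k j)))))])
     xs)) xs)) xs))"

lemma twins_formula:
  assumes "3 \<le> length xs" "distinct xs"
  shows "vars (twins_formula xs) \<subseteq> set xs"
    "finite_graph G \<Longrightarrow> (\<forall>x\<in>set xs. e x \<in> pverts G) \<Longrightarrow> sat G e (twins_formula xs) \<longleftrightarrow>
      inj_on e (set xs) \<and> (\<forall>x\<in>set xs. \<forall>y\<in>set xs. similar G (e x) (e y))"
proof -
  have third: "\<exists>k\<in>set xs. k \<noteq> i \<and> k \<noteq> j" for i j
  proof (rule ccontr)
    assume "\<not> ?thesis"
    then have "set xs \<subseteq> {i, j}" by blast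
    then have "card (set xs) \<le> card {i, j}" by (intro card_mono) auto
    also have "\<dots> \<le> 2" by (simp add: card_insert_le_m1)
    finally show False using assms by (simp add: distinct_card)
  qed
  let ?F = "\<lambda>i j k. [Neg (Eq i j), Neg (Exi k (Conj (Conj (Neg (Eq k i)) (Neg (Eq k j))) (Conj (Adj k i) (Neg (Adj k j)))))]"
  let ?L = "concat (map (\<lambda>i. concat (map (\<lambda>j. concat (map (\<lambda>k.
     if i = j \<or> i = k \<or> j = k then [] else ?F i j k) xs)) xs)) xs)"
  have set: "\<phi> \<in> set ?L \<longleftrightarrow> (\<exists>i\<in>set xs. \<exists>j\<in>set xs. \<exists>k\<in>set xs. i \<noteq> j \<and> i \<noteq> k \<and> j \<noteq> k \<and> \<phi> \<in> set (?F i j k))" for \<phi>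
    by auto
  obtain i where i: "i \<in> set xs" using third by blast
  obtain j where j: "j \<in> set xs" "j \<noteq> i" using third[of i i] by blast
  obtain k where k: "k \<in> set xs" "k \<noteq> i" "k \<noteq> j" using third by blast
  have "Neg (Eq i j) \<in> set ?L" unfolding set
    by (intro bexI[OF _ i] bexI[OF _ j(1)] bexI[OF _ k(1)]) (use j k in auto)
  then have ne: "?L \<noteq> []" by (metis list.set(1) empty_iff)
  have "vars \<phi> \<subseteq> set xs" if "\<phi> \<in> set ?L" for \<phi>
    using that unfolding set by auto
  then show "vars (twins_formula xs) \<subseteq> set xs"
    unfolding twins_formula_def vars_conjs[OF ne] by blast
  \<comment> \<open>Which third variable \<open>k\<close> is reused does not affect the meaning, and
    at least one is available.\<close>
  have drop: "(\<forall>k\<in>set xs. i \<noteq> j \<and> i \<noteq> k \<and> j \<noteq> k \<longrightarrow> Q) \<longleftrightarrow> (i \<noteq> j \<longrightarrow> Q)" for i j Q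
  proof -
    obtain k where "k \<in> set xs" "k \<noteq> i" "k \<noteq> j" using third[of i j] by blast
    then show ?thesis by auto
  qed
  assume G: "finite_graph G" and e: "\<forall>x\<in>set xs. e x \<in> pverts G"
  have "sat G e (twins_formula xs) \<longleftrightarrow> (\<forall>\<phi>\<in>set ?L. sat G e \<phi>)"
    unfolding twins_formula_def sat_conjs ..
  also have "\<dots> \<longleftrightarrow> (\<forall>i\<in>set xs. \<forall>j\<in>set xs. \<forall>k\<in>set xs. i \<noteq> j \<and> i \<noteq> k \<and> j \<noteq> k \<longrightarrow>
      (\<forall>\<phi>\<in>set (?F i j k). sat G e \<phi>))"
    unfolding Ball_def set by blast
  also have "\<dots> \<longleftrightarrow> (\<forall>i\<in>set xs. \<forall>j\<in>set xs. \<forall>k\<in>set xs. i \<noteq> j \<and> i \<noteq> k \<and> j \<noteq> k \<longrightarrow>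
      e i \<noteq> e j \<and> (\<forall>w\<in>pverts G. w \<noteq> e i \<longrightarrow> w \<noteq> e j \<longrightarrow> (w, e i) \<in> parcs G \<longrightarrow> (w, e j) \<in> parcs G))"
    by auto
  also have "\<dots> \<longleftrightarrow> (\<forall>i\<in>set xs. \<forall>j\<in>set xs. i \<noteq> j \<longrightarrow>
      e i \<noteq> e j \<and> (\<forall>w\<in>pverts G. w \<noteq> e i \<longrightarrow> w \<noteq> e j \<longrightarrow> (w, e i) \<in> parcs G \<longrightarrow> (w, e j) \<in> parcs G))"
    by (simp only: drop)
  also have "\<dots> \<longleftrightarrow> inj_on e (set xs) \<and> (\<forall>x\<in>set xs. \<forall>y\<in>set xs. similar G (e x) (e y))"
    (is "?L \<longleftrightarrow> ?R")
  proof
    assume L: ?L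
    \<comment> \<open>The formula for \<open>(i, j)\<close> only forbids neighbours of
      \<open>e i\<close> missed by \<open>e j\<close>; the converse comes from
      \<open>(j, i)\<close>.\<close>
    have "similar G (e i) (e j)" if "i \<in> set xs" "j \<in> set xs" for i j
      using L that e by (cases "i = j") (auto simp: similar_def)
    then show ?R using L by (auto simp: inj_on_def)
  next
    assume ?R
    then have inj: "inj_on e (set xs)" and sim: "\<And>i j. i \<in> set xs \<Longrightarrow> j \<in> set xs \<Longrightarrow> similar G (e i) (e j)"
      by blast+
    then show ?L
    proof (intro ballI impI conjI)
      fix i j assume ij: "i \<in> set xs" "j \<in> set xs" "i \<noteq> j"
      then show "e i \<noteq> e j" using inj by (simp add: inj_on_eq_iff)
      fix w assume "w \<in> pverts G" "w \<noteq> e i" "w \<noteq> e j" "(w, e i) \<in> parcs G"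
      then show "(w, e j) \<in> parcs G" using sim[OF ij(1,2)] by (simp add: similar_def)
    qed
  qed
  finally show "sat G e (twins_formula xs) \<longleftrightarrow>
      inj_on e (set xs) \<and> (\<forall>x\<in>set xs. \<forall>y\<in>set xs. similar G (e x) (e y))" .
qed

lemma free_vars_subset_vars: "free_vars \<phi> \<subseteq> vars \<phi>"
  by (induction \<phi>) auto

text \<open>The formula denies that \<open>sigma G + 1\<close> vertices are pairwise twins;
  \<open>sigma G\<close> being at least 2 supplies the third variable to be reused.\<close>

lemma width_dist_larger_class:
  assumes G: "finite_graph G" and H: "finite_graph H" and less: "sigma G < sigma H"
    and two: "2 \<le> sigma G"
  shows "width_dist G H \<le> enat (sigma G + 1)"
proof -
  let ?xs = "[1..<sigma G + 2]"
  let ?\<phi> = "Neg (foldr Exi ?xs (twins_formula ?xs))"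
  have xs: "3 \<le> length ?xs" "distinct ?xs" "set ?xs = {1..sigma G + 1}" using two by auto
  note tf = twins_formula[OF xs(1,2)]
  have sat: "sat K e (foldr Exi ?xs (twins_formula ?xs)) \<longleftrightarrow> (\<exists>a. a ` {1..sigma G + 1} \<subseteq> pverts K \<and>
      inj_on a {1..sigma G + 1} \<and> (\<forall>x\<in>{1..sigma G + 1}. \<forall>y\<in>{1..sigma G + 1}. similar K (a x) (a y)))"
    if K: "finite_graph K" for K :: "'c pair_pre_digraph" and e
  proof -
    have eq: "sat K (\<lambda>x. if x \<in> set ?xs then a x else e x) (twins_formula ?xs) \<longleftrightarrow> 
      inj_on a {1..sigma G + 1} \<and> (\<forall>x\<in>{1..sigma G + 1}. \<forall>y\<in>{1..sigma G + 1}. similar K (a x) (a y))"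
      if "\<forall>x\<in>set ?xs. a x \<in> pverts K" for a
      using that by (subst tf(2)[OF K]) (simp_all only: xs(3) inj_on_def if_True ball_triv simp_thms cong: ball_cong)
    then show ?thesis
      unfolding sat_foldr_Exi[OF xs(2)] image_subset_iff xs(3)[symmetric]
      by (intro iff_exI conj_cong refl) (simp only: xs(3))
  qed
  have "models G ?\<phi>"
  proof -
    have False if "inj_on a {1..sigma G + 1}"
      "\<forall>x\<in>{1..sigma G + 1}. \<forall>y\<in>{1..sigma G + 1}. similar G (a x) (a y)" for a
    proof -
      have "card (a ` {1..sigma G + 1}) \<le> sigma G"
        by (rule similar_card_le_sigma[OF G]) (use that in blast)
      then show False using that(1) by (simp add: card_image)
    qed
    then show ?thesis unfolding models_def sat.simps sat[OF G] by blast
  qed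
  moreover have "\<not> models H ?\<phi>"
  proof -
    obtain u where u: "card (sim_class H u) = sigma H" using obtain_largest_class[OF H] by blast
    have "\<exists>a. a ` {1..sigma G + 1} \<subseteq> sim_class H u \<and> inj_on a {1..sigma G + 1}"
      using u less by (intro card_le_inj finite_subset[OF sim_class_subset[OF H] finite_graphD(1)[OF H]]) auto
    then obtain a where a: "a ` {1..sigma G + 1} \<subseteq> sim_class H u" "inj_on a {1..sigma G + 1}" by blast
    then have "\<exists>a. a ` {1..sigma G + 1} \<subseteq> pverts H \<and>
      inj_on a {1..sigma G + 1} \<and> (\<forall>x\<in>{1..sigma G + 1}. \<forall>y\<in>{1..sigma G + 1}. similar H (a x) (a y))"
      using sim_class_subset[OF H] sim_class_similar[OF H] by (intro exI[of _ a]) blast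
    then show ?thesis unfolding models_def sat.simps sat[OF H] by blast
  qed
  moreover have "vars ?\<phi> \<subseteq> {1..sigma G + 1}" using tf(1) xs(3) by auto
  moreover have "free_vars ?\<phi> = {}" using tf(1) free_vars_subset_vars[of "twins_formula ?xs"] by auto
  ultimately show ?thesis
    unfolding width_dist_def distinguishes_def by (intro INF_lower) blast
qed

lemma width_le:
  assumes G: "finite_graph G"
  shows "width G \<le> enat (max ((order G + 5) div 2) (sigma G + 1))"
  unfolding width_def
proof (rule SUP_least)
  fix H :: "nat pair_pre_digraph"
  assume "H \<in> {H. finite_graph H \<and> \<not> isomorphic G H}"
  then have H: "finite_graph H" and ni: "\<not> isomorphic G H" by auto
  let ?R = "(order G + 5) div 2"
  have pos: "0 < ?R" by simp
  have up: "width_dist G H \<le> enat (max ?R (sigma G + 1))"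
    if "width_dist G H \<le> enat r" "r \<le> max ?R (sigma G + 1)" for r
    using that by (meson enat_ord_simps(1) order_trans)
  show "width_dist G H \<le> enat (max ?R (sigma G + 1))"
  proof (cases "game 1 QEx G H ?R {} \<and> game 1 QAll G H ?R {}")
    case False
    then show ?thesis using width_dist_le[OF G pos] up[of ?R] by auto
  next
    case True
    then consider "sigma H < sigma G" | "sigma G < sigma H" "2 \<le> sigma G" | "sigma G < sigma H" "sigma G \<le> 1"
      using isomorphic_or_sigma_differs[OF G H] ni by linarith
    then show ?thesis
    proof cases
      case 1
      then have "\<not> game 1 QEx G H (sigma G + 1) {}" by (intro larger_class_wins[OF G H]) auto
      then have "width_dist G H \<le> enat (sigma G + 1)" by (rule width_dist_le[OF G, rotated]) simp
      then show ?thesis by (rule up) simp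
    next
      case 2
      then show ?thesis using width_dist_larger_class[OF G H] up by auto
    next
      case 3
      \<comment> \<open>With classes of a single vertex there is no third variable to reuse, but the
        separating round is affordable: \<open>sigma G + 2\<close> is at most 3, and so many rounds
        are always there.\<close>
      have "1 \<le> order G"
        using finite_graphD(1,2)[OF G] by (simp add: order_def Suc_le_eq card_gt_0_iff)
      then have "sigma G + 2 \<le> ?R" using 3 by linarith
      then have "\<not> game 1 QEx H G ?R {}" using 3 by (intro larger_class_wins[OF H G])
      then show ?thesis using True game_swap_initial[of 1 G H ?R] by blast
    qed
  qed
qed

section \<open>Lower bounds\<close>

lemma quantifier_rank_simps [simp]:
  "quantifier_rank (Adj x y) = 0" "quantifier_rank (Eq x y) = 0"
  "quantifier_rank (Neg \<phi>) = quantifier_rank \<phi>"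
  "quantifier_rank (Conj \<phi> \<psi>) = max (quantifier_rank \<phi>) (quantifier_rank \<psi>)"
  "quantifier_rank (Disj \<phi> \<psi>) = max (quantifier_rank \<phi>) (quantifier_rank \<psi>)"
  "quantifier_rank (Exi x \<phi>) = Suc (quantifier_rank \<phi>)"
  "quantifier_rank (All x \<phi>) = Suc (quantifier_rank \<phi>)"
proof -
  have Suc: "Max (Suc ` length ` Nest \<phi>) = Suc (Max (length ` Nest \<phi>))" for \<phi>
    using Nest_finite_nonempty[of \<phi>] by (intro mono_Max_commute[symmetric]) (auto simp: mono_def)
  show "quantifier_rank (Exi x \<phi>) = Suc (quantifier_rank \<phi>)"
    "quantifier_rank (All x \<phi>) = Suc (quantifier_rank \<phi>)"
    using Suc[of \<phi>] by (simp_all add: quantifier_rank_def image_image)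
qed (use Nest_finite_nonempty in \<open>auto simp: quantifier_rank_def image_Un image_image Max_Un\<close>)

text \<open>\<open>K r F e e'\<close> says that the duplicator survives \<open>r\<close> more rounds when the variables in \<open>F\<close>
  have the values given by \<open>e\<close> and \<open>e'\<close>.\<close>

lemma back_and_forth:
  assumes atom: "\<And>r F e e' x y. K r F e e' \<Longrightarrow> x \<in> F \<Longrightarrow> y \<in> F \<Longrightarrow>
      (e x = e y \<longleftrightarrow> e' x = e' y) \<and> ((e x, e y) \<in> parcs G \<longleftrightarrow> (e' x, e' y) \<in> parcs H)"
    and forward: "\<And>r F e e' x a. K (Suc r) F e e' \<Longrightarrow> x \<in> V \<Longrightarrow> a \<in> pverts G \<Longrightarrow>
      \<exists>b\<in>pverts H. K r (insert x F) (e(x := a)) (e'(x := b))"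
    and backward: "\<And>r F e e' x b. K (Suc r) F e e' \<Longrightarrow> x \<in> V \<Longrightarrow> b \<in> pverts H \<Longrightarrow>
      \<exists>a\<in>pverts G. K r (insert x F) (e(x := a)) (e'(x := b))"
  shows "K r F e e' \<Longrightarrow> free_vars \<phi> \<subseteq> F \<Longrightarrow> vars \<phi> \<subseteq> V \<Longrightarrow> quantifier_rank \<phi> \<le> r \<Longrightarrow>
    sat G e \<phi> \<longleftrightarrow> sat H e' \<phi>"
proof (induction \<phi> arbitrary: r F e e')
  case (Exi x \<phi>)
  then obtain r' where r': "r = Suc r'" "quantifier_rank \<phi> \<le> r'" by (cases r) auto
  have F: "free_vars \<phi> \<subseteq> insert x F" "vars \<phi> \<subseteq> V" "x \<in> V" using Exi.prems by auto
  show ?case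
    using forward[of r' F e e' x] backward[of r' F e e' x] Exi.IH[OF _ F(1,2) r'(2)] Exi.prems(1) F(3) r'(1)
    by (simp only: sat.simps) metis
next
  case (All x \<phi>)
  then obtain r' where r': "r = Suc r'" "quantifier_rank \<phi> \<le> r'" by (cases r) auto
  have F: "free_vars \<phi> \<subseteq> insert x F" "vars \<phi> \<subseteq> V" "x \<in> V" using All.prems by auto
  show ?case
    using forward[of r' F e e' x] backward[of r' F e e' x] All.IH[OF _ F(1,2) r'(2)] All.prems(1) F(3) r'(1)
    by (simp only: sat.simps) metis
qed (use atom in auto)

section \<open>Enlarging a similarity class by one twin\<close>

definition original :: "'a \<Rightarrow> 'a option \<Rightarrow> 'a" where
  "original u p = (case p of None \<Rightarrow> u | Some x \<Rightarrow> x)"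

text \<open>The vertex \<open>None\<close> is a new twin of \<open>u\<close>, adjacent to \<open>u\<close> iff \<open>c\<close>.\<close>

definition add_twin :: "bool \<Rightarrow> 'a \<Rightarrow> 'a pair_pre_digraph \<Rightarrow> 'a option pair_pre_digraph" where
  "add_twin c u G = \<lparr>pverts = insert None (Some ` pverts G),
     parcs = {(p, q). p \<in> insert None (Some ` pverts G) \<and> q \<in> insert None (Some ` pverts G) \<and> p \<noteq> q \<and>
       ((original u p, original u q) \<in> parcs G \<or> c \<and> original u p = original u q)}\<rparr>"

text \<open>\<open>c\<close> is the adjacency inside the class of \<open>u\<close>; for a one-vertex
  class \<open>flag\<close> is vacuous and either value is allowed.\<close>

locale twin_extension =
  fixes G :: "'a pair_pre_digraph" and u :: 'a and c :: bool
  assumes G: "finite_graph G" and u: "u \<in> pverts G"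
    and flag: "\<And>x y. x \<in> sim_class G u \<Longrightarrow> y \<in> sim_class G u \<Longrightarrow> x \<noteq> y \<Longrightarrow> (x, y) \<in> parcs G \<longleftrightarrow> c"
begin

abbreviation "C \<equiv> sim_class G u"
abbreviation "H \<equiv> add_twin c u G"

lemma pverts_H: "pverts H = insert None (Some ` pverts G)"
  by (simp add: add_twin_def)

lemma parcs_H: "(p, q) \<in> parcs H \<longleftrightarrow> p \<in> pverts H \<and> q \<in> pverts H \<and> p \<noteq> q \<and>
    ((original u p, original u q) \<in> parcs G \<or> c \<and> original u p = original u q)"
  by (simp add: add_twin_def)

lemma original_simps [simp]: "original u None = u" "original u (Some x) = x"
  by (simp_all add: original_def)

lemma finite_graph_H: "finite_graph H"
  using finite_graphD(1)[OF G] finite_graphD(6)[OF G] unfolding finite_graph_iff parcs_H pverts_H by auto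

lemma card_H: "card (pverts H) = Suc (card (pverts G))"
  using finite_graphD(1)[OF G] by (simp add: pverts_H card_image)

lemma not_isomorphic: "\<not> isomorphic G H"
  using card_H bij_betw_same_card by (fastforce simp: isomorphic_def isomorphism_def)

lemma u_C: "u \<in> C" using u by (simp add: sim_class_eq[OF G] similar_refl)

lemma C_sub: "C \<subseteq> pverts G" by (rule sim_class_subset[OF G])

definition C' where "C' = {p \<in> pverts H. original u p \<in> C}"

lemma card_C': "card C' = Suc (card C)"
proof -
  have "C' = insert None (Some ` C)" using u_C C_sub by (auto simp: C'_def pverts_H)
  moreover have "finite C" using C_sub finite_graphD(1)[OF G] by (rule finite_subset)
  ultimately show ?thesis by (simp add: card_image)
qed

lemma adj_C':
  assumes "p \<in> C'" "q \<in> C'" "p \<noteq> q"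
  shows "(p, q) \<in> parcs H \<longleftrightarrow> c"
proof (cases "original u p = original u q")
  case True
  then show ?thesis using assms finite_graphD(5)[OF G] by (simp add: C'_def parcs_H)
next
  case False
  have "original u p \<in> C" "original u q \<in> C" using assms by (auto simp: C'_def)
  then have "(original u p, original u q) \<in> parcs G \<longleftrightarrow> c" using False by (rule flag)
  then show ?thesis using assms False by (simp add: C'_def parcs_H)
qed

text \<open>The duplicator copies vertices outside the class; inside it members are interchangeable,
  so only equalities have to be preserved.\<close>

definition inv :: "nat set \<Rightarrow> (nat \<Rightarrow> 'a) \<Rightarrow> (nat \<Rightarrow> 'a option) \<Rightarrow> bool" where
  "inv F e e' \<longleftrightarrow> (\<forall>x\<in>F. e x \<in> pverts G \<and> e' x \<in> pverts H \<and> (e x \<in> C \<longleftrightarrow> e' x \<in> C') \<and>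
       (e x \<notin> C \<longrightarrow> e' x = Some (e x))) \<and>
     (\<forall>x\<in>F. \<forall>y\<in>F. e x = e y \<longleftrightarrow> e' x = e' y)"

lemma invD:
  assumes "inv F e e'" "x \<in> F"
  shows "e x \<in> pverts G" "e' x \<in> pverts H" "e x \<in> C \<longleftrightarrow> e' x \<in> C'" "e x \<notin> C \<Longrightarrow> e' x = Some (e x)"
    "y \<in> F \<Longrightarrow> e x = e y \<longleftrightarrow> e' x = e' y"
  using assms unfolding inv_def by blast+

text \<open>Within the class adjacency is \<open>c\<close> in both graphs; for a mixed pair the
  member of the class is replaced by a twin.\<close>

lemma inv_atom:
  assumes inv: "inv F e e'" and xy: "x \<in> F" "y \<in> F"
  shows "(e x = e y \<longleftrightarrow> e' x = e' y) \<and> ((e x, e y) \<in> parcs G \<longleftrightarrow> (e' x, e' y) \<in> parcs H)"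
proof -
  have eq: "e x = e y \<longleftrightarrow> e' x = e' y" by (rule invD(5)[OF inv xy])
  have one: "(e x, e y) \<in> parcs G \<longleftrightarrow> (e' x, e' y) \<in> parcs H"
    if "x \<in> F" "y \<in> F" "e x \<in> C" "e y \<notin> C" for x y
  proof -
    have "e x \<noteq> e y" using that by auto
    then have "e' x \<in> C'" "e' y = Some (e y)" "e y \<in> pverts G" "e' x \<noteq> e' y"
      using invD(3)[OF inv that(1)] invD(4)[OF inv that(2,4)] invD(1)[OF inv that(2)]
        invD(5)[OF inv that(1,2)] that(3) by simp_all
    then have "similar G (e x) (original u (e' x))" "(e' x, e' y) \<in> parcs H \<longleftrightarrow> (original u (e' x), e y) \<in> parcs G"
      using that sim_class_similar[OF G] by (auto simp: C'_def parcs_H pverts_H)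
    moreover have "e y \<noteq> e x" "e y \<noteq> original u (e' x)" using that \<open>e' x \<in> C'\<close> by (auto simp: C'_def)
    ultimately show ?thesis
      using \<open>e y \<in> pverts G\<close> finite_graphD(6)[OF G, of "e y" "e x"]
        finite_graphD(6)[OF G, of "e y" "original u (e' x)"] unfolding similar_def by blast
  qed
  have "(e x, e y) \<in> parcs G \<longleftrightarrow> (e' x, e' y) \<in> parcs H"
  proof (cases "e x = e y")
    case True
    then show ?thesis using eq finite_graphD(5)[OF G] finite_graphD(5)[OF finite_graph_H] by simp
  next
    case ne: False
    consider "e x \<in> C" "e y \<in> C" | "e x \<in> C" "e y \<notin> C" | "e x \<notin> C" "e y \<in> C" | "e x \<notin> C" "e y \<notin> C" by blast
    then show ?thesis
    proof cases
      case 1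
      then have "e' x \<in> C'" "e' y \<in> C'" "e' x \<noteq> e' y"
        using invD(3)[OF inv xy(1)] invD(3)[OF inv xy(2)] eq ne by simp_all
      then show ?thesis using flag[OF 1 ne] adj_C' by simp
    next
      case 2
      then show ?thesis using one xy by blast
    next
      case 3
      then show ?thesis using one[of y x] xy finite_graphD(6)[OF G, of "e x" "e y"]
          finite_graphD(6)[OF finite_graph_H, of "e' x" "e' y"] by blast
    next
      case 4
      then have "e' x = Some (e x)" "e' y = Some (e y)" "e x \<in> pverts G" "e y \<in> pverts G"
        using invD(4)[OF inv xy(1)] invD(4)[OF inv xy(2)] invD(1)[OF inv xy(1)] invD(1)[OF inv xy(2)]
        by simp_all
      then show ?thesis using ne by (simp add: parcs_H pverts_H)
    qed
  qed
  then show ?thesis using eq by blast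
qed

lemma inv_update:
  assumes "inv F e e'" "a \<in> pverts G" "b \<in> pverts H" "a \<in> C \<longleftrightarrow> b \<in> C'" "a \<notin> C \<Longrightarrow> b = Some a"
    and "\<And>y. y \<in> F - {x} \<Longrightarrow> e y = a \<longleftrightarrow> e' y = b"
  shows "inv (insert x F) (e(x := a)) (e'(x := b))"
  unfolding inv_def
proof (intro conjI ballI)
  fix y assume y: "y \<in> insert x F"
  show "(e(x := a)) y \<in> pverts G"
    using y assms(2) invD(1)[OF assms(1), of y] by (cases "y = x") simp_all
  show "(e'(x := b)) y \<in> pverts H"
    using y assms(3) invD(2)[OF assms(1), of y] by (cases "y = x") simp_all
  show "(e(x := a)) y \<in> C \<longleftrightarrow> (e'(x := b)) y \<in> C'"
    using y assms(4) invD(3)[OF assms(1), of y] by (cases "y = x") simp_all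
  show "(e(x := a)) y \<notin> C \<longrightarrow> (e'(x := b)) y = Some ((e(x := a)) y)"
    using y assms(5) invD(4)[OF assms(1), of y] by (cases "y = x") simp_all
next
  fix y z assume y: "y \<in> insert x F" and z: "z \<in> insert x F"
  show "(e(x := a)) y = (e(x := a)) z \<longleftrightarrow> (e'(x := b)) y = (e'(x := b)) z"
    using y z invD(5)[OF assms(1), of y z] assms(6)[of y] assms(6)[of z]
    by (cases "y = x"; cases "z = x") (auto simp: eq_commute[of a])
qed

lemma inv_update_old:
  assumes inv: "inv F e e'" and y: "y \<in> F - {x}"
  shows "inv (insert x F) (e(x := e y)) (e'(x := e' y))"
proof (rule inv_update[OF inv])
  have y': "y \<in> F" using y by simp
  show "e y \<in> pverts G" "e' y \<in> pverts H" "e y \<in> C \<longleftrightarrow> e' y \<in> C'" "e y \<notin> C \<Longrightarrow> e' y = Some (e y)"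
    by (rule invD[OF inv y'], assumption?)+
  show "e z = e y \<longleftrightarrow> e' z = e' y" if "z \<in> F - {x}" for z
    using invD(5)[OF inv, of z y] that y' by simp
qed

lemma inv_update_outside:
  assumes inv: "inv F e e'" and a: "a \<in> pverts G" "a \<notin> C"
  shows "inv (insert x F) (e(x := a)) (e'(x := Some a))"
proof (rule inv_update[OF inv a(1)])
  have not_in: "Some a \<notin> C'" using a by (simp add: C'_def)
  then show "a \<in> C \<longleftrightarrow> Some a \<in> C'" using a by simp
  show "Some a \<in> pverts H" using a by (simp add: pverts_H)
  show "e z = a \<longleftrightarrow> e' z = Some a" if "z \<in> F - {x}" for z
  proof (cases "e z \<in> C")
    case True
    then have "e' z \<in> C'" using invD(3)[OF inv, of z] that by simp
    then have "e' z \<noteq> Some a" using not_in by metis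
    moreover have "e z \<noteq> a" using True a by metis
    ultimately show ?thesis by simp
  next
    case False
    then show ?thesis using invD(4)[OF inv, of z] that by simp
  qed
qed simp

lemma inv_update_fresh:
  assumes inv: "inv F e e'" and a: "a \<in> C" "a \<notin> e ` (F - {x})" and b: "b \<in> C'" "b \<notin> e' ` (F - {x})"
  shows "inv (insert x F) (e(x := a)) (e'(x := b))"
proof (rule inv_update[OF inv])
  show "a \<in> pverts G" using a C_sub by blast
  show "b \<in> pverts H" using b by (simp add: C'_def)
  show "e z = a \<longleftrightarrow> e' z = b" if "z \<in> F - {x}" for z
    using a(2) b(2) that by blast
qed (use a b in simp_all)

text \<open>\<open>C'\<close> has |C| + 1 vertices, so |C| held ones leave a fresh answer. The set
  \<open>F - {x}\<close> appears because requantifying \<open>x\<close> releases its vertex.\<close>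

lemma inv_forth:
  assumes inv: "inv F e e'" and a: "a \<in> pverts G" and fin: "finite F" and card: "card (F - {x}) \<le> card C"
  shows "\<exists>b\<in>pverts H. inv (insert x F) (e(x := a)) (e'(x := b))"
proof -
  consider "a \<notin> C" | y where "y \<in> F - {x}" "e y = a" | "a \<in> C" "a \<notin> e ` (F - {x})" by blast
  then show ?thesis
  proof cases
    case 1
    then show ?thesis
      using inv_update_outside[OF inv a 1] a by (intro bexI[of _ "Some a"]) (simp_all add: pverts_H)
  next
    case 2
    then show ?thesis
      using inv_update_old[OF inv 2(1)] invD(2)[OF inv, of y] by (intro bexI[of _ "e' y"]) simp_all
  next
    case 3
    have "card (e' ` (F - {x})) < card C'"
      using card_image_le[of "F - {x}" e'] fin card card_C' by simp
    then have "\<not> C' \<subseteq> e' ` (F - {x})"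
      using card_mono[of "e' ` (F - {x})" C'] fin by auto
    then obtain b where b: "b \<in> C'" "b \<notin> e' ` (F - {x})" by blast
    then show ?thesis
      using inv_update_fresh[OF inv 3 b] by (intro bexI[of _ b]) (simp_all add: C'_def)
  qed
qed

text \<open>The only danger is a fresh vertex of \<open>C'\<close> chosen while all of
  \<open>C\<close> is held; this one extra round of delay is what the lower bounds measure.\<close>

lemma inv_back:
  assumes inv: "inv F e e'" and b: "b \<in> pverts H"
    and free: "b \<in> e' ` (F - {x}) \<or> b \<notin> C' \<or> \<not> C \<subseteq> e ` (F - {x})"
  shows "\<exists>a\<in>pverts G. inv (insert x F) (e(x := a)) (e'(x := b))"
proof -
  consider y where "y \<in> F - {x}" "e' y = b" | "b \<notin> C'"
    | a where "b \<in> C'" "b \<notin> e' ` (F - {x})" "a \<in> C" "a \<notin> e ` (F - {x})" using free by blast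
  then show ?thesis
  proof cases
    case 1
    then show ?thesis
      using inv_update_old[OF inv 1(1)] invD(1)[OF inv, of y] by (intro bexI[of _ "e y"]) simp_all
  next
    case 2
    then obtain a where a: "b = Some a" "a \<in> pverts G" "a \<notin> C"
      using b u_C by (auto simp: C'_def pverts_H)
    then show ?thesis using inv_update_outside[OF inv a(2,3)] by blast
  next
    case 3
    then show ?thesis using inv_update_fresh[OF inv 3(3,4,1,2)] C_sub by blast
  qed
qed

lemma not_covered:
  assumes "finite F" "card (F - {x}) < card C"
  shows "\<not> C \<subseteq> e ` (F - {x})"
  using assms card_mono[of "e ` (F - {x})" C] card_image_le[of "F - {x}" e] by fastforce

text \<open>When \<open>x\<close> is requantified, at most |C| - 1 other variables hold vertices. So
  \<open>C\<close> is never exhausted, and the duplicator survives for formulas of any rank.\<close>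

lemma few_variables_agree:
  assumes vars: "vars \<phi> \<subseteq> {1..card C}" and closed: "free_vars \<phi> = {}"
  shows "models G \<phi> \<longleftrightarrow> models H \<phi>"
proof -
  let ?K = "\<lambda>r :: nat. \<lambda>F e e'. inv F e e' \<and> F \<subseteq> {1..card C}"
  have card: "finite F \<and> card (F - {x}) < card C" if "F \<subseteq> {1..card C}" "x \<in> {1..card C}" for F x
  proof -
    have "card (F - {x}) \<le> card ({1..card C} - {x})" using that by (intro card_mono) auto
    then show ?thesis using that by (auto intro: finite_subset)
  qed
  have "sat G e \<phi> \<longleftrightarrow> sat H e' \<phi>" for e e'
  proof (rule back_and_forth[where K = ?K and r = "quantifier_rank \<phi>" and F = "{}" and V = "{1..card C}"])
    fix r F e e' x a assume K: "?K (Suc r) F e e'" and x: "x \<in> {1..card C}" and a: "a \<in> pverts G"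
    then show "\<exists>b\<in>pverts H. ?K r (insert x F) (e(x := a)) (e'(x := b))"
      using inv_forth[of F e e' a x] card[of F x] by simp
  next
    fix r F e e' x b assume K: "?K (Suc r) F e e'" and x: "x \<in> {1..card C}" and b: "b \<in> pverts H"
    then show "\<exists>a\<in>pverts G. ?K r (insert x F) (e(x := a)) (e'(x := b))"
      using inv_back[of F e e' b x] not_covered[of F x e] card[of F x] by simp
  next
    fix r F e e' x y assume "?K r F e e'" "x \<in> F" "y \<in> F"
    then show "(e x = e y \<longleftrightarrow> e' x = e' y) \<and> ((e x, e y) \<in> parcs G \<longleftrightarrow> (e' x, e' y) \<in> parcs H)"
      using inv_atom[of F e e' x y] by simp
  qed (use vars in \<open>simp_all add: inv_def closed\<close>)
  then show ?thesis unfolding models_def by blast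
qed

lemma low_rank_agree:
  assumes rank: "quantifier_rank \<phi> \<le> card C" and closed: "free_vars \<phi> = {}"
  shows "models G \<phi> \<longleftrightarrow> models H \<phi>"
proof -
  let ?K = "\<lambda>r F e e'. inv F e e' \<and> finite F \<and> card F + r \<le> card C"
  have card: "finite (insert x F) \<and> card (insert x F) + r \<le> card C \<and> card (F - {x}) < card C"
    if "finite F" "card F + Suc r \<le> card C" for F r and x :: nat
    using that card_mono[of F "F - {x}"] by (auto simp: card_insert_if)
  have "sat G e \<phi> \<longleftrightarrow> sat H e' \<phi>" for e e'
  proof (rule back_and_forth[where K = ?K and r = "quantifier_rank \<phi>" and F = "{}" and V = UNIV])
    fix r F e e' x a assume K: "?K (Suc r) F e e'" and a: "a \<in> pverts G"
    then show "\<exists>b\<in>pverts H. ?K r (insert x F) (e(x := a)) (e'(x := b))"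
      using inv_forth[of F e e' a x] card[of F r x] by simp
  next
    fix r F e e' x b assume K: "?K (Suc r) F e e'" and b: "b \<in> pverts H"
    then show "\<exists>a\<in>pverts G. ?K r (insert x F) (e(x := a)) (e'(x := b))"
      using inv_back[of F e e' b x] not_covered[of F x e] card[of F r x] by simp
  next
    fix r F e e' x y assume "?K r F e e'" "x \<in> F" "y \<in> F"
    then show "(e x = e y \<longleftrightarrow> e' x = e' y) \<and> ((e x, e y) \<in> parcs G \<longleftrightarrow> (e' x, e' y) \<in> parcs H)"
      using inv_atom[of F e e' x y] by simp
  qed (simp_all add: inv_def rank closed)
  then show ?thesis unfolding models_def by blast
qed

text \<open>If the class can be enlarged to a homogeneous set by \<open>v\<close>, the duplicator survives one more
  round: when the spoiler has exhausted the enlarged class in \<open>H\<close>, she answers \<open>v\<close>.\<close>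

lemma low_rank_agree_extendable:
  assumes v: "v \<in> pverts G" "v \<notin> C" "\<And>x. x \<in> C \<Longrightarrow> (v, x) \<in> parcs G \<longleftrightarrow> c"
    and rank: "quantifier_rank \<phi> \<le> card C + 1" and closed: "free_vars \<phi> = {}"
  shows "models G \<phi> \<longleftrightarrow> models H \<phi>"
proof -
  define iso where "iso F e e' \<longleftrightarrow> (\<forall>x\<in>F. \<forall>y\<in>F. (e x = e y \<longleftrightarrow> e' x = e' y) \<and>
    ((e x, e y) \<in> parcs G \<longleftrightarrow> (e' x, e' y) \<in> parcs H))" for F :: "nat set" and e e'
  \<comment> \<open>Answering a vertex of \<open>C'\<close> by \<open>v\<close> violates
    \<open>inv\<close>, as \<open>v\<close> lies outside \<open>C\<close>; this is tolerated only
    after the last round, where a partial isomorphism suffices.\<close>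
  let ?K = "\<lambda>r F e e'. (inv F e e' \<or> r = 0 \<and> iso F e e') \<and> finite F \<and> card F + r \<le> card C + 1"
  have card: "finite (insert x F) \<and> card (insert x F) + r \<le> card C + 1 \<and> card (F - {x}) \<le> card C"
    if "finite F" "card F + Suc r \<le> card C + 1" for F r and x :: nat
    using that card_mono[of F "F - {x}"] by (auto simp: card_insert_if)
  have "sat G e \<phi> \<longleftrightarrow> sat H e' \<phi>" for e e'
  proof (rule back_and_forth[where K = ?K and r = "quantifier_rank \<phi>" and F = "{}" and V = UNIV])
    fix r F e e' x a assume K: "?K (Suc r) F e e'" and a: "a \<in> pverts G"
    then show "\<exists>b\<in>pverts H. ?K r (insert x F) (e(x := a)) (e'(x := b))"
      using inv_forth[of F e e' a x] card[of F r x] by auto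
  next
    fix r F e e' x b assume K: "?K (Suc r) F e e'" and b: "b \<in> pverts H"
    then have inv: "inv F e e'" and fin: "finite F" and cF: "card F + Suc r \<le> card C + 1" by auto
    note card' = card[OF fin cF, of x]
    show "\<exists>a\<in>pverts G. ?K r (insert x F) (e(x := a)) (e'(x := b))"
    proof (cases "b \<in> e' ` (F - {x}) \<or> b \<notin> C' \<or> \<not> C \<subseteq> e ` (F - {x})")
      case True
      then show ?thesis using inv_back[OF inv b] card' by blast
    next
      case False
      then have b': "b \<in> C'" "b \<notin> e' ` (F - {x})" and sub: "C \<subseteq> e ` (F - {x})" by auto
      have le: "card (e ` (F - {x})) \<le> card (F - {x})" "card C \<le> card (e ` (F - {x}))"
        using fin sub by (auto intro: card_image_le card_mono)
      \<comment> \<open>The budget leaves at most |C| held vertices and \<open>C\<close> is covered,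
        so every held vertex lies in the class and this is the last round.\<close>
      have "C = e ` (F - {x})" using card_subset_eq[OF _ sub] fin le card' by simp
      then have eC: "e y \<in> C" "e' y \<in> C'" if "y \<in> F" "y \<noteq> x" for y
        using inv that by (auto simp: inv_def)
      have "r = 0" using le card' cF card_mono[OF fin, of "F - {x}"] by auto
      have adj: "(v, e y) \<in> parcs G \<longleftrightarrow> (b, e' y) \<in> parcs H" "(e y, v) \<in> parcs G \<longleftrightarrow> (e' y, b) \<in> parcs H"
        "v \<noteq> e y" "b \<noteq> e' y" if "y \<in> F" "y \<noteq> x" for y
      proof -
        show ne: "v \<noteq> e y" "b \<noteq> e' y" using eC[OF that] v b' that by auto
        show one: "(v, e y) \<in> parcs G \<longleftrightarrow> (b, e' y) \<in> parcs H"
          using v(3) eC[OF that] adj_C'[of b "e' y"] ne b' by blast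
        show "(e y, v) \<in> parcs G \<longleftrightarrow> (e' y, b) \<in> parcs H"
          using one finite_graphD(6)[OF G, of v "e y"] finite_graphD(6)[OF finite_graph_H, of b "e' y"] by blast
      qed
      have "iso (insert x F) (e(x := v)) (e'(x := b))"
        unfolding iso_def
      proof (intro ballI)
        fix y z assume yz: "y \<in> insert x F" "z \<in> insert x F"
        consider "y = x" "z = x" | "y = x" "z \<noteq> x" | "y \<noteq> x" "z = x" | "y \<noteq> x" "z \<noteq> x" by blast
        then show "((e(x := v)) y = (e(x := v)) z \<longleftrightarrow> (e'(x := b)) y = (e'(x := b)) z) \<and>
            (((e(x := v)) y, (e(x := v)) z) \<in> parcs G \<longleftrightarrow> ((e'(x := b)) y, (e'(x := b)) z) \<in> parcs H)"
        proof cases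
          case 1
          then show ?thesis using finite_graphD(5)[OF G] finite_graphD(5)[OF finite_graph_H] by simp
        next
          case 2
          then show ?thesis using adj[of z] yz by simp
        next
          case 3
          then show ?thesis using adj[of y] yz by auto
        next
          case 4
          then show ?thesis using inv_atom[OF inv, of y z] yz by simp
        qed
      qed
      then show ?thesis using v(1) \<open>r = 0\<close> card' by blast
    qed
  next
    fix r F e e' x y assume "?K r F e e'" "x \<in> F" "y \<in> F"
    then show "(e x = e y \<longleftrightarrow> e' x = e' y) \<and> ((e x, e y) \<in> parcs G \<longleftrightarrow> (e' x, e' y) \<in> parcs H)"
      using inv_atom[of F e e' x y] unfolding iso_def by blast
  qed (use rank closed in \<open>simp_all add: inv_def\<close>)
  then show ?thesis unfolding models_def by blast
qed

lemma width_ge: "enat (card C + 1) \<le> width G"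
proof -
  obtain K :: "nat pair_pre_digraph" where K: "finite_structure K" "isomorphic H K"
    using finite_structure_nat[OF finite_graph_finite_structure[OF finite_graph_H]] by blast
  have KG: "finite_graph K" by (rule isomorphic_finite_graph[OF finite_graph_H K])
  have ni: "\<not> isomorphic G K" using not_isomorphic isomorphic_trans isomorphic_sym[OF K(2)] by blast
  have "enat (card C + 1) \<le> width_dist G K"
    unfolding width_dist_def
  proof (rule INF_greatest)
    fix l assume "l \<in> {l. \<exists>\<phi>. vars \<phi> \<subseteq> {1..l} \<and> distinguishes \<phi> G K}"
    then obtain \<phi> where \<phi>: "vars \<phi> \<subseteq> {1..l}" "distinguishes \<phi> G K" by blast
    have closed: "free_vars \<phi> = {}" using \<phi> by (simp add: distinguishes_def)
    have "models H \<phi> \<longleftrightarrow> models K \<phi>"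
      by (rule models_isomorphic[OF K(2) closed]) (simp add: pverts_H)
    then have "\<not> vars \<phi> \<subseteq> {1..card C}" using few_variables_agree closed \<phi> by (auto simp: distinguishes_def)
    then have "\<not> l \<le> card C" using \<phi>(1) by force
    then show "enat (card C + 1) \<le> enat l" by simp
  qed
  also have "\<dots> \<le> width G" unfolding width_def using KG ni by (intro SUP_upper) simp
  finally show ?thesis .
qed

lemma depth_geI:
  assumes "\<And>\<phi>. quantifier_rank \<phi> \<le> k \<Longrightarrow> free_vars \<phi> = {} \<Longrightarrow> models G \<phi> \<longleftrightarrow> models H \<phi>"
  shows "enat (k + 1) \<le> depth G"
  unfolding depth_def
proof (rule INF_greatest)
  fix \<phi> assume "\<phi> \<in> {\<phi>. fo_defines \<phi> G}"
  then have "distinguishes \<phi> G H"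
    using fo_defines_any_type finite_graph_finite_structure[OF finite_graph_H] not_isomorphic by blast
  then have "\<not> quantifier_rank \<phi> \<le> k" using assms by (auto simp: distinguishes_def)
  then show "enat (k + 1) \<le> enat (quantifier_rank \<phi>)" by simp
qed

end

section \<open>Lower bounds from the largest class, and the final case analysis\<close>

lemma largest_class_twin_extension:
  assumes G: "finite_graph G" and C: "largest_class G C"
  obtains u c where "twin_extension G u c" "C = sim_class G u"
proof -
  obtain u where u: "u \<in> pverts G" "C = sim_class G u" using C by (auto simp: largest_class_def)
  have "homogeneous G C" using similar_homogeneous[OF G] sim_class_similar[OF G] u(2) by blast
  then obtain c where c: "\<And>x y. x \<in> C \<Longrightarrow> y \<in> C \<Longrightarrow> x \<noteq> y \<Longrightarrow> (x, y) \<in> parcs G \<longleftrightarrow> c"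
    using homogeneousE by blast
  have "twin_extension G u c" by unfold_locales (use G u c in auto)
  then show ?thesis using that u by blast
qed

lemma largest_class_exists:
  assumes "finite_graph G" shows "\<exists>C. largest_class G C"
  using obtain_largest_class[OF assms] by (auto simp: largest_class_def)

lemma width_gt_sigma:
  assumes G: "finite_graph G" shows "enat (sigma G + 1) \<le> width G"
proof -
  obtain C where C: "largest_class G C" using largest_class_exists[OF G] by blast
  obtain u c where "twin_extension G u c" "C = sim_class G u"
    by (rule largest_class_twin_extension[OF G C])
  then show ?thesis using twin_extension.width_ge C by (fastforce simp: largest_class_def)
qed

lemma depth_gt_sigma:
  assumes G: "finite_graph G" shows "enat (sigma G + 1) \<le> depth G"
proof -
  obtain C where C: "largest_class G C" using largest_class_exists[OF G] by blast
  obtain u c where t: "twin_extension G u c" "C = sim_class G u"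
    by (rule largest_class_twin_extension[OF G C])
  interpret twin_extension G u c by fact
  show ?thesis using depth_geI[OF low_rank_agree] C t(2) by (simp add: largest_class_def)
qed

lemma depth_gt_Suc_sigma:
  assumes G: "finite_graph G" and C: "largest_class G C" "\<not> maximal_homogeneous G C"
  shows "enat (sigma G + 2) \<le> depth G"
proof -
  obtain u where u: "u \<in> pverts G" "C = sim_class G u" using C by (auto simp: largest_class_def)
  have "homogeneous G C" using similar_homogeneous[OF G] sim_class_similar[OF G] u(2) by blast
  then obtain Y where Y: "homogeneous G Y" "C \<subseteq> Y" "Y \<noteq> C" using C(2) by (auto simp: maximal_homogeneous_def)
  \<comment> \<open>The adjacency is taken from \<open>Y\<close>, because a one-vertex class has
    none of its own and the new twin has to match \<open>v\<close>.\<close>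
  obtain c where c: "\<And>x y. x \<in> Y \<Longrightarrow> y \<in> Y \<Longrightarrow> x \<noteq> y \<Longrightarrow> (x, y) \<in> parcs G \<longleftrightarrow> c"
    using homogeneousE[OF Y(1)] by blast
  have YV: "Y \<subseteq> pverts G" using Y(1) by (simp add: homogeneous_def)
  obtain v where v: "v \<in> Y" "v \<notin> C" using Y by blast
  have vG: "v \<in> pverts G" "v \<notin> sim_class G u" using v YV u(2) by auto
  have size: "card (sim_class G u) = sigma G" using C u(2) by (simp add: largest_class_def)
  have sub: "sim_class G u \<subseteq> Y" using Y(2) u(2) by simp
  interpret twin_extension G u c by unfold_locales (use G u c sub in auto)
  have vC: "(v, x) \<in> parcs G \<longleftrightarrow> c" if "x \<in> sim_class G u" for x
  proof (rule c)
    show "v \<noteq> x" using vG(2) that by metis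
  qed (use v sub that in auto)
  have "enat (card (sim_class G u) + 1 + 1) \<le> depth G"
    by (rule depth_geI, rule low_rank_agree_extendable[OF vG vC])
  then show ?thesis by (simp add: size)
qed

theorem theorem4p6:
  fixes G :: "'a pair_pre_digraph"
  assumes "finite_graph G"
  shows "(ereal_of_enat (width G) \<le> ereal ((real (order G) + 5) / 2) \<longleftrightarrow> G \<notin> class_S)
       \<and> (G \<in> class_S \<longrightarrow> width G = enat (sigma G + 1))
       \<and> (ereal_of_enat (depth_alt 1 G) \<le> ereal ((real (order G) + 5) / 2)
            \<longleftrightarrow> G \<notin> class_S1 \<union> class_S2)
       \<and> (G \<in> class_S1 \<longrightarrow> depth G = enat (sigma G + 1))
       \<and> (G \<in> class_S2 \<longrightarrow> depth G = enat (sigma G + 2))"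
proof -
  note G = assms
  let ?n = "order G" and ?s = "sigma G"
  let ?R = "(?n + 5) div 2"
  have le: "ereal_of_enat x \<le> ereal ((real ?n + 5) / 2) \<longleftrightarrow> x \<le> enat ?R" for x
  proof (cases x)
    case (enat k)
    have "real k \<le> (real ?n + 5) / 2 \<longleftrightarrow> real (2 * k) \<le> real (?n + 5)" by (simp add: field_simps)
    also have "\<dots> \<longleftrightarrow> k \<le> ?R" unfolding of_nat_le_iff by linarith
    finally show ?thesis using enat by simp
  qed simp
  have S: "G \<in> class_S \<longleftrightarrow> ?n + 3 < 2 * ?s"
    "G \<in> class_S1 \<longleftrightarrow> ?n + 3 < 2 * ?s \<and> (\<exists>C. largest_class G C \<and> maximal_homogeneous G C)"
    "G \<in> class_S2 \<longleftrightarrow> ?n + 1 < 2 * ?s \<and> (\<exists>C. largest_class G C \<and> \<not> maximal_homogeneous G C)"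
    using G by (auto simp: class_S_def class_S1_def class_S2_def)
  have a: "width G \<le> enat ?R \<longleftrightarrow> G \<notin> class_S" "G \<in> class_S \<Longrightarrow> width G = enat (?s + 1)"
  proof -
    have up: "width G \<le> enat (max ?R (?s + 1))" and low: "enat (?s + 1) \<le> width G"
      using width_le[OF G] width_gt_sigma[OF G] .
    show w: "width G = enat (?s + 1)" if "G \<in> class_S"
    proof -
      have "max ?R (?s + 1) = ?s + 1" using that S by linarith
      then show ?thesis using up low by simp
    qed
    show "width G \<le> enat ?R \<longleftrightarrow> G \<notin> class_S"
    proof
      assume "G \<notin> class_S"
      then have "max ?R (?s + 1) = ?R" using S by linarith
      then show "width G \<le> enat ?R" using up by simp
    next
      assume "width G \<le> enat ?R"
      then show "G \<notin> class_S" using w S by fastforce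
    qed
  qed
  have S1: "depth_alt 1 G \<le> enat (?s + 1)" "enat (?s + 1) \<le> depth G" "?R < ?s + 1" if "G \<in> class_S1"
  proof -
    show "depth_alt 1 G \<le> enat (?s + 1)"
      by (rule depth_alt_1_le[OF G]) (use that S(2) in auto)
    show "enat (?s + 1) \<le> depth G" by (rule depth_gt_sigma[OF G])
    show "?R < ?s + 1" using that S(2) by linarith
  qed
  have S2: "depth_alt 1 G \<le> enat (?s + 2)" "enat (?s + 2) \<le> depth G" "?R < ?s + 2" if "G \<in> class_S2"
  proof -
    show "depth_alt 1 G \<le> enat (?s + 2)"
      by (rule depth_alt_1_le[OF G]) (use that S(3) in auto)
    show "enat (?s + 2) \<le> depth G" using depth_gt_Suc_sigma[OF G] that S(3) by blast
    show "?R < ?s + 2" using that S(3) by linarith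
  qed
  have other: "depth_alt 1 G \<le> enat ?R" if n: "G \<notin> class_S1 \<union> class_S2"
  proof (cases "?s + 2 \<le> ?R")
    case True
    then show ?thesis by (intro depth_alt_1_le[OF G]) auto
  next
    case False
    \<comment> \<open>Outside \<open>class_S2\<close> this makes the largest class maximal
      homogeneous, and outside \<open>class_S1\<close> it leaves 2 \<open>sigma G\<close> <= n + 3,
      so \<open>sigma G + 1\<close> rounds fit into the general bound.\<close>
    then have large: "?n + 1 < 2 * ?s" by linarith
    obtain C where C: "largest_class G C" using largest_class_exists[OF G] by blast
    then have max: "maximal_homogeneous G C" using n large S(3) by blast
    then have "\<not> ?n + 3 < 2 * ?s" using n C S(2) by blast
    then show ?thesis using C max large by (intro depth_alt_1_le[OF G]) auto
  qed
  have "depth_alt 1 G \<le> enat ?R \<longleftrightarrow> G \<notin> class_S1 \<union> class_S2"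
  proof
    assume ub: "depth_alt 1 G \<le> enat ?R"
    \<comment> \<open>The lower bounds concern formulas with unrestricted alternation, which is
      stronger than what \<open>depth_alt\<close> asks for.\<close>
    then have "depth G \<le> enat ?R" using depth_le_depth_alt[of G 1] by (rule order_trans[rotated])
    then have "\<not> enat k \<le> depth G" if "?R < k" for k
      using that by (meson enat_ord_simps(1) leD le_less_trans order_trans)
    then show "G \<notin> class_S1 \<union> class_S2" using S1(2,3) S2(2,3) by blast
  qed (rule other)
  moreover have "depth G = enat (?s + 1)" if "G \<in> class_S1"
    using S1[OF that] depth_le_depth_alt[of G 1] by (metis order_antisym order_trans)
  moreover have "depth G = enat (?s + 2)" if "G \<in> class_S2"
    using S2[OF that] depth_le_depth_alt[of G 1] by (metis order_antisym order_trans)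
  ultimately show ?thesis using a unfolding le by blast
qed

end
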